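(* Let $G$ be the chain graph with vertex set $\{1,2,3,4\}$ and edges $1\to 3$, $2-3$, $3-4$, and let $G_{\mathrm{sing}}$ be the subgraph that has the edges $2-3$ and $3-4$ deleted. If all four variables are binary ($d_1=d_2=d_3=d_4=2$), then the singular locus of $\mathbf{P}_{\mathrm{II}}(G)$ is equal to the submodel $\mathbf{P}_{\mathrm{II}}(G_{\mathrm{sing}})=\mathbf{P}_{\mathrm{IV}}(G_{\mathrm{sing}})$.
   Context: $X=(X_1,X_2,X_3,X_4)$ is a random vector with $X_v$ taking values in $\{1,2\}$. Joint distributions are identified with probability vectors $p=(p(i))$, $p(i)=P(X=i)$, $i\in\{1,2\}^4$; $\Delta^o$ is the set of those with all entries positive. $\alpha\perp\!\!\!\perp\beta\mid\gamma$ denotes conditional independence of $X_\alpha$ and $X_\beta$ given $X_\gamma$. For a chain graph $H$, $\mathbf{P}_{\mathrm{II}}(H)$ and $\mathbf{P}_{\mathrm{IV}}(H)$ denote the sets of $p\in\Delta^o$ obeying the block-recursive Markov properties of type II (AMP) and type IV (multivariate regression), respectively. For the graphs at hand these are as follows. - $G$ has chain components $\{1\}$ and $\{2,3,4\}$, and $\mathbf{P}_{\mathrm{II}}(G)$ is the set of $p\in\Delta^o$ with $2\perp\!\!\!\perp4\mid\{1,3\}$ and $1\perp\!\!\!\perp\{2,4\}$. - $G_{\mathrm{sing}}$ has the single edge $1\to3$ and all its chain components are singletons; the type II and type IV properties then both consist of the statements $1\perp\!\!\!\perp\{2,4\}$, $2\perp\!\!\!\perp\{1,3,4\}$, $4\perp\!\!\!\perp\{1,2,3\}$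 and $3\perp\!\!\!\perp\{2,4\}\mid1$. Singular locus. On the set of $p\in\Delta^o$ with $1\perp\!\!\!\perp\{2,4\}$, use the coordinates $q_1=P(X_1=1)$ together with the eleven coordinates $q_2=P(X_2=1)$, $q_4=P(X_4=1)$, $q_{24}=P(X_2=1,X_4=1)$ and, for $i=1,2$, $q_{3|i}=P(X_3=1\mid X_1=i)$, $q_{23|i}=P(X_2=1,X_3=1\mid X_1=i)$, $q_{34|i}=P(X_3=1,X_4=1\mid X_1=i)$, $q_{234|i}=P(X_2=1,X_3=1,X_4=1\mid X_1=i)$. In these coordinates $\mathbf{P}_{\mathrm{II}}(G)$ is cut out by the following equations, not involving $q_1$, for $i=1,2$: $$q_{23|i}q_{34|i}=q_{3|i}q_{234|i},\qquad q_{3|i}q_{24}-q_{23|i}q_4-q_{34|i}q_2+q_{234|i}=q_{24}-q_2q_4 .$$ Let $W\subseteq\mathbb{R}^{11}$ be the algebraic set defined by these four equations. The singular locus of $\mathbf{P}_{\mathrm{II}}(G)$ is the set of $p\in\mathbf{P}_{\mathrm{II}}(G)$ whose eleven coordinates form a singular point of $W$ in the usual sense of algebraic geometry, i.e. a point at which the dimension of the Zariski tangent space (defined by the vanishing ideal of $W$) differs from the local dimension of $W$. *)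

theory Defs
  imports "HOL-Probability.Probability"
begin

section \<open>Conditional independence of discrete random vectors\<close>

text \<open>A joint distribution of \<open>X = (X\<^sub>v)\<^sub>v\<close> is a probability mass function on the
  configurations \<open>i :: 'v \<Rightarrow> 's\<close>; the random variable \<open>X\<^sub>v\<close> is the projection \<open>\<lambda>i. i v\<close>.\<close>

definition positive_pmfs :: "('v::finite \<Rightarrow> 's::finite) pmf set" where
  "positive_pmfs = {p. \<forall>i. pmf p i > 0}"

definition cond_indep ::
    "('v::finite \<Rightarrow> 's::finite) pmf \<Rightarrow> 'v set \<Rightarrow> 'v set \<Rightarrow> 'v set \<Rightarrow> bool" where
  "cond_indep p A B C \<longleftrightarrow> (\<forall>x y z.
     \<P>(i in measure_pmf p. \<forall>v\<in>C. i v = z v) > 0 \<longrightarrow>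
     \<P>(i in measure_pmf p. (\<forall>v\<in>A. i v = x v) \<and> (\<forall>v\<in>B. i v = y v) \<bar> \<forall>v\<in>C. i v = z v) =
     \<P>(i in measure_pmf p. \<forall>v\<in>A. i v = x v \<bar> \<forall>v\<in>C. i v = z v) *
     \<P>(i in measure_pmf p. \<forall>v\<in>B. i v = y v \<bar> \<forall>v\<in>C. i v = z v))"


section \<open>Chain graphs and block-recursive Markov properties\<close>

text \<open>The vertex set is the whole type. An undirected edge is listed in both orientations.\<close>

record 'v mixed_graph =
  arrows :: "('v \<times> 'v) set"
  lines :: "('v \<times> 'v) set"

definition chain_components :: "'v mixed_graph \<Rightarrow> 'v set set" where
  "chain_components H = UNIV // (lines H)\<^sup>*"

definition component_arrows :: "'v mixed_graph \<Rightarrow> ('v set \<times> 'v set) set" where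
  "component_arrows H = {(\<sigma>, \<tau>). \<sigma> \<in> chain_components H \<and> \<tau> \<in> chain_components H \<and>
     (\<exists>v\<in>\<sigma>. \<exists>w\<in>\<tau>. (v, w) \<in> arrows H)}"

text \<open>An arrow inside a chain component is a loop of \<^const>\<open>component_arrows\<close>, so acyclicity
  excludes all semi-directed cycles as well as multiple edges.\<close>

definition chain_graph :: "'v mixed_graph \<Rightarrow> bool" where
  "chain_graph H \<longleftrightarrow> sym (lines H) \<and> irrefl (lines H) \<and> acyclic (component_arrows H)"

definition pa :: "'v mixed_graph \<Rightarrow> 'v set \<Rightarrow> 'v set" where
  "pa H \<sigma> = {v. \<exists>w\<in>\<sigma>. (v, w) \<in> arrows H}"

definition nb :: "'v mixed_graph \<Rightarrow> 'v set \<Rightarrow> 'v set" where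
  "nb H \<sigma> = {v. \<exists>w\<in>\<sigma>. (v, w) \<in> lines H} - \<sigma>"

definition pa_comp :: "'v mixed_graph \<Rightarrow> 'v set \<Rightarrow> 'v set" where
  "pa_comp H \<tau> = \<Union>{\<sigma>. (\<sigma>, \<tau>) \<in> component_arrows H}"

definition nd_comp :: "'v mixed_graph \<Rightarrow> 'v set \<Rightarrow> 'v set" where
  "nd_comp H \<tau> = \<Union>{\<sigma> \<in> chain_components H. (\<tau>, \<sigma>) \<notin> (component_arrows H)\<^sup>*}"

text \<open>Block-recursive Markov properties as in M. Drton, Discrete chain graph models,
  Bernoulli 15 (2009): type II (AMP) consists of C1, C2a and C3b, type IV (multivariate
  regression) of C1, C2b and C3b. The lemmas \<open>model_II_G\<close> and \<open>model_G_sing\<close> below list the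
  resulting independence statements for the two graphs at hand.\<close>

definition markov_C1 :: "'v::finite mixed_graph \<Rightarrow> ('v \<Rightarrow> 's::finite) pmf \<Rightarrow> bool" where
  "markov_C1 H p \<longleftrightarrow> (\<forall>\<tau>\<in>chain_components H.
     cond_indep p \<tau> (nd_comp H \<tau> - pa_comp H \<tau>) (pa_comp H \<tau>))"

definition markov_C2a :: "'v::finite mixed_graph \<Rightarrow> ('v \<Rightarrow> 's::finite) pmf \<Rightarrow> bool" where
  "markov_C2a H p \<longleftrightarrow> (\<forall>\<tau>\<in>chain_components H. \<forall>\<sigma>\<subseteq>\<tau>.
     cond_indep p \<sigma> (\<tau> - (nb H \<sigma> \<union> \<sigma>)) (pa_comp H \<tau> \<union> nb H \<sigma>))"

definition markov_C2b :: "'v::finite mixed_graph \<Rightarrow> ('v \<Rightarrow> 's::finite) pmf \<Rightarrow> bool" where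
  "markov_C2b H p \<longleftrightarrow> (\<forall>\<tau>\<in>chain_components H. \<forall>\<sigma>\<subseteq>\<tau>.
     cond_indep p \<sigma> (\<tau> - (nb H \<sigma> \<union> \<sigma>)) (pa_comp H \<tau>))"

definition markov_C3b :: "'v::finite mixed_graph \<Rightarrow> ('v \<Rightarrow> 's::finite) pmf \<Rightarrow> bool" where
  "markov_C3b H p \<longleftrightarrow> (\<forall>\<tau>\<in>chain_components H. \<forall>\<sigma>\<subseteq>\<tau>.
     cond_indep p \<sigma> (pa_comp H \<tau> - pa H \<sigma>) (pa H \<sigma>))"

definition model_II :: "'v::finite mixed_graph \<Rightarrow> ('v \<Rightarrow> 's::finite) pmf set" where
  "model_II H = {p \<in> positive_pmfs. markov_C1 H p \<and> markov_C2a H p \<and> markov_C3b H p}"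

definition model_IV :: "'v::finite mixed_graph \<Rightarrow> ('v \<Rightarrow> 's::finite) pmf set" where
  "model_IV H = {p \<in> positive_pmfs. markov_C1 H p \<and> markov_C2b H p \<and> markov_C3b H p}"


section \<open>The graphs\<close>

text \<open>In the numeral type \<open>4\<close> we have \<open>4 = 0\<close>; its elements are \<open>1, 2, 3, 4\<close>.
  Likewise the elements of the type \<open>2\<close> are \<open>1\<close> and \<open>2\<close>.\<close>

definition G :: "4 mixed_graph" where
  "G = \<lparr>arrows = {(1, 3)}, lines = {(2, 3), (3, 2), (3, 4), (4, 3)}\<rparr>"

definition G_sing :: "4 mixed_graph" where
  "G_sing = G\<lparr>lines := lines G - {(2, 3), (3, 2), (3, 4), (4, 3)}\<rparr>"


section \<open>Real algebraic sets\<close>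

definition algebraic_set :: "'a::euclidean_space set \<Rightarrow> bool" where
  "algebraic_set Z \<longleftrightarrow>
     (\<exists>F. (\<forall>f\<in>F. real_polynomial_function f) \<and> Z = {x. \<forall>f\<in>F. f x = 0})"

definition zariski :: "'a::euclidean_space topology" where
  "zariski = topology (\<lambda>U. algebraic_set (- U))"

definition irreducible_space :: "'a topology \<Rightarrow> bool" where
  "irreducible_space X \<longleftrightarrow> topspace X \<noteq> {} \<and>
     (\<forall>A B. closedin X A \<and> closedin X B \<and> A \<union> B = topspace X \<longrightarrow>
        A = topspace X \<or> B = topspace X)"

text \<open>For the empty space this gives \<open>0\<close>; only nonempty spaces occur in \<open>local_dim\<close>.\<close>

definition krull_dim :: "'a topology \<Rightarrow> enat" where
  "krull_dim X = Sup {enat n | n. \<exists>Z :: nat \<Rightarrow> 'a set.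
     (\<forall>k\<le>n. closedin X (Z k) \<and> irreducible_space (subtopology X (Z k))) \<and>
     (\<forall>k<n. Z k \<subset> Z (Suc k))}"

definition local_dim :: "'a topology \<Rightarrow> 'a \<Rightarrow> enat" where
  "local_dim X x = Inf {krull_dim (subtopology X U) | U. openin X U \<and> x \<in> U}"

definition vanishing_ideal :: "'a::euclidean_space set \<Rightarrow> ('a \<Rightarrow> real) set" where
  "vanishing_ideal V = {f. real_polynomial_function f \<and> (\<forall>x\<in>V. f x = 0)}"

definition zariski_tangent_space :: "'a::euclidean_space set \<Rightarrow> 'a \<Rightarrow> 'a set" where
  "zariski_tangent_space V x =
     {v. \<forall>f\<in>vanishing_ideal V. frechet_derivative f (at x) v = 0}"

definition singular_point :: "'a::euclidean_space set \<Rightarrow> 'a \<Rightarrow> bool" where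
  "singular_point V x \<longleftrightarrow> x \<in> V \<and>
     enat (dim (zariski_tangent_space V x)) \<noteq> local_dim (subtopology zariski V) x"


section \<open>Coordinates and the singular locus\<close>

text \<open>\<open>Q3 a\<close> stands for the coordinate \<open>q\<^sub>3\<^sub>|\<^sub>a\<close>, and so on; \<open>real ^ coord\<close> is the
  eleven-dimensional coordinate space.\<close>

datatype coord = Q2 | Q4 | Q24 | Q3 "2" | Q23 "2" | Q34 "2" | Q234 "2"

lemma UNIV_coord:
  "(UNIV :: coord set) = {Q2, Q4, Q24, Q3 1, Q3 2, Q23 1, Q23 2, Q34 1, Q34 2, Q234 1, Q234 2}"
proof -
  have "k \<in> {Q2, Q4, Q24, Q3 1, Q3 2, Q23 1, Q23 2, Q34 1, Q34 2, Q234 1, Q234 2}" for k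
    by (cases k) (simp_all, (metis exhaust_2)+)
  then show ?thesis by blast
qed

instance coord :: finite
  by standard (simp add: UNIV_coord)

lemma CARD_coord: "CARD(coord) = 11"
  by (simp add: UNIV_coord)

definition coordinates :: "(4 \<Rightarrow> 2) pmf \<Rightarrow> real ^ coord" where
  "coordinates p = (\<chi> k. case k of
       Q2 \<Rightarrow> \<P>(i in measure_pmf p. i 2 = 1)
     | Q4 \<Rightarrow> \<P>(i in measure_pmf p. i 4 = 1)
     | Q24 \<Rightarrow> \<P>(i in measure_pmf p. i 2 = 1 \<and> i 4 = 1)
     | Q3 a \<Rightarrow> \<P>(i in measure_pmf p. i 3 = 1 \<bar> i 1 = a)
     | Q23 a \<Rightarrow> \<P>(i in measure_pmf p. i 2 = 1 \<and> i 3 = 1 \<bar> i 1 = a)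
     | Q34 a \<Rightarrow> \<P>(i in measure_pmf p. i 3 = 1 \<and> i 4 = 1 \<bar> i 1 = a)
     | Q234 a \<Rightarrow> \<P>(i in measure_pmf p. i 2 = 1 \<and> i 3 = 1 \<and> i 4 = 1 \<bar> i 1 = a))"

definition W :: "(real ^ coord) set" where
  "W = {q. \<forall>a.
     q $ Q23 a * q $ Q34 a = q $ Q3 a * q $ Q234 a \<and>
     q $ Q3 a * q $ Q24 - q $ Q23 a * q $ Q4 - q $ Q34 a * q $ Q2 + q $ Q234 a
       = q $ Q24 - q $ Q2 * q $ Q4}"

definition singular_locus :: "(4 \<Rightarrow> 2) pmf set" where
  "singular_locus = {p \<in> model_II G. singular_point W (coordinates p)}"


section \<open>Consistency of the definitions\<close>

lemma istopology_zariski: "istopology (\<lambda>U :: 'a::euclidean_space set. algebraic_set (- U))"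
  unfolding istopology_def
proof (intro conjI allI impI)
  fix S T :: "'a set"
  assume "algebraic_set (- S)" "algebraic_set (- T)"
  then obtain E F where E: "\<forall>f\<in>E. real_polynomial_function f" "- S = {x. \<forall>f\<in>E. f x = 0}"
    and F: "\<forall>f\<in>F. real_polynomial_function f" "- T = {x. \<forall>f\<in>F. f x = 0}"
    unfolding algebraic_set_def by blast
  let ?H = "(\<lambda>(f, g) x. f x * g x) ` (E \<times> F)"
  have "- (S \<inter> T) = {x. \<forall>h\<in>?H. h x = 0}"
  proof (rule set_eqI)
    fix x
    have "x \<in> - (S \<inter> T) \<longleftrightarrow> (\<forall>f\<in>E. f x = 0) \<or> (\<forall>g\<in>F. g x = 0)"
      using E(2) F(2) by auto
    also have "\<dots> \<longleftrightarrow> (\<forall>f\<in>E. \<forall>g\<in>F. f x * g x = 0)"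
      unfolding mult_eq_0_iff by blast
    also have "\<dots> \<longleftrightarrow> (\<forall>h\<in>?H. h x = 0)"
      by simp
    finally show "x \<in> - (S \<inter> T) \<longleftrightarrow> x \<in> {x. \<forall>h\<in>?H. h x = 0}"
      by (simp only: mem_Collect_eq)
  qed
  moreover have "\<forall>h\<in>?H. real_polynomial_function h"
  proof
    fix h assume "h \<in> ?H"
    then obtain f g where fg: "f \<in> E" "g \<in> F" and h: "h = (\<lambda>x. f x * g x)" by auto
    show "real_polynomial_function h"
      unfolding h using fg E(1) F(1) by (intro real_polynomial_function.intros(4)) blast+
  qed
  ultimately show "algebraic_set (- (S \<inter> T))"
    unfolding algebraic_set_def by (intro exI[of _ ?H] conjI)
next
  fix K :: "'a set set"
  assume "\<forall>U\<in>K. algebraic_set (- U)"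
  define F where "F U = vanishing_ideal (- U)" for U :: "'a set"
  have F: "- U = {x. \<forall>f\<in>F U. f x = 0}" if "U \<in> K" for U
  proof -
    have "algebraic_set (- U)" using \<open>\<forall>U\<in>K. algebraic_set (- U)\<close> that by (rule bspec)
    then obtain E where E: "\<forall>f\<in>E. real_polynomial_function f" "- U = {x. \<forall>f\<in>E. f x = 0}"
      unfolding algebraic_set_def by blast
    then have "E \<subseteq> F U" unfolding F_def vanishing_ideal_def E(2) by blast
    then have "{x. \<forall>f\<in>F U. f x = 0} \<subseteq> - U" unfolding E(2) by blast
    moreover have "- U \<subseteq> {x. \<forall>f\<in>F U. f x = 0}" by (simp add: F_def vanishing_ideal_def subset_iff)
    ultimately show ?thesis by (rule subset_antisym[rotated])
  qed
  have "- \<Union>K = {x. \<forall>f\<in>\<Union>(F ` K). f x = 0}"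
  proof (rule set_eqI)
    fix x
    have "x \<in> - \<Union>K \<longleftrightarrow> (\<forall>U\<in>K. x \<in> - U)" by blast
    also have "\<dots> \<longleftrightarrow> (\<forall>U\<in>K. \<forall>f\<in>F U. f x = 0)" by (simp only: F mem_Collect_eq cong: ball_cong)
    finally show "x \<in> - \<Union>K \<longleftrightarrow> x \<in> {x. \<forall>f\<in>\<Union>(F ` K). f x = 0}" by simp
  qed
  moreover have "\<forall>f\<in>\<Union>(F ` K). real_polynomial_function f"
    by (auto simp: F_def vanishing_ideal_def)
  ultimately show "algebraic_set (- \<Union>K)"
    unfolding algebraic_set_def by (intro exI[of _ "\<Union>(F ` K)"] conjI)
qed

lemma openin_zariski: "openin zariski U \<longleftrightarrow> algebraic_set (- U)"
  unfolding zariski_def topology_inverse'[OF istopology_zariski] ..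

lemma topspace_zariski [simp]: "topspace (zariski :: 'a::euclidean_space topology) = UNIV"
proof -
  have "- UNIV = {x :: 'a. \<forall>f\<in>{\<lambda>_. 1}. f x = (0 :: real)}" by simp
  moreover have "\<forall>f\<in>{\<lambda>_ :: 'a. 1}. real_polynomial_function f"
    using real_polynomial_function.intros(2) by blast
  ultimately have "algebraic_set (- UNIV :: 'a set)"
    unfolding algebraic_set_def by (intro exI[of _ "{\<lambda>_. 1}"] conjI)
  then have "openin zariski (UNIV :: 'a set)" unfolding openin_zariski .
  then show ?thesis by (metis UNIV_I openin_subset subsetI subset_antisym)
qed

lemma closedin_zariski: "closedin zariski Z \<longleftrightarrow> algebraic_set Z"
  unfolding closedin_def openin_zariski topspace_zariski Compl_eq_Diff_UNIV [symmetric] double_compl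
  by (simp only: subset_UNIV simp_thms)

lemma cond_indep_commute: "cond_indep p A B C \<longleftrightarrow> cond_indep p B A C"
proof -
  have "cond_indep p B A C" if "cond_indep p A B C" for A B
    unfolding cond_indep_def
  proof (intro allI impI)
    fix x y z
    assume "\<P>(i in measure_pmf p. \<forall>v\<in>C. i v = z v) > 0"
    with that have
      "\<P>(i in measure_pmf p. (\<forall>v\<in>A. i v = y v) \<and> (\<forall>v\<in>B. i v = x v) \<bar> \<forall>v\<in>C. i v = z v) =
       \<P>(i in measure_pmf p. \<forall>v\<in>A. i v = y v \<bar> \<forall>v\<in>C. i v = z v) *
       \<P>(i in measure_pmf p. \<forall>v\<in>B. i v = x v \<bar> \<forall>v\<in>C. i v = z v)"
      unfolding cond_indep_def by simp
    then show
      "\<P>(i in measure_pmf p. (\<forall>v\<in>B. i v = x v) \<and> (\<forall>v\<in>A. i v = y v) \<bar> \<forall>v\<in>C. i v = z v) =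
       \<P>(i in measure_pmf p. \<forall>v\<in>B. i v = x v \<bar> \<forall>v\<in>C. i v = z v) *
       \<P>(i in measure_pmf p. \<forall>v\<in>A. i v = y v \<bar> \<forall>v\<in>C. i v = z v)"
      by (simp only: conj_commute mult.commute)
  qed
  then show ?thesis by blast
qed

lemma cond_indep_empty [simp]: "cond_indep p {} B C" "cond_indep p A {} C"
  by (auto simp: cond_indep_def cond_prob_def)

lemma cond_indep_mono:
  assumes ci: "cond_indep p A B C" and sub: "A' \<subseteq> A"
  shows "cond_indep p A' B C"
  unfolding cond_indep_def
proof (intro allI impI)
  fix x y z :: "'a \<Rightarrow> 'b"
  assume pos: "\<P>(i in measure_pmf p. \<forall>v\<in>C. i v = z v) > 0"
  define T where "T = {w. \<forall>v. v \<notin> A \<or> v \<in> A' \<longrightarrow> w v = x v}"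
  have split: "\<P>(i in measure_pmf p. (\<forall>v\<in>A'. i v = x v) \<and> R i \<bar> \<forall>v\<in>C. i v = z v) =
      (\<Sum>w\<in>T. \<P>(i in measure_pmf p. (\<forall>v\<in>A. i v = w v) \<and> R i \<bar> \<forall>v\<in>C. i v = z v))" for R
  proof -
    let ?S = "\<lambda>w. {i. ((\<forall>v\<in>A. i v = w v) \<and> R i) \<and> (\<forall>v\<in>C. i v = z v)}"
    have "{i. ((\<forall>v\<in>A'. i v = x v) \<and> R i) \<and> (\<forall>v\<in>C. i v = z v)} = (\<Union>w\<in>T. ?S w)"
    proof (intro equalityI subsetI)
      fix i assume i: "i \<in> {i. ((\<forall>v\<in>A'. i v = x v) \<and> R i) \<and> (\<forall>v\<in>C. i v = z v)}"
      then have "(\<lambda>v. if v \<in> A then i v else x v) \<in> T" by (auto simp: T_def)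
      moreover have "i \<in> ?S (\<lambda>v. if v \<in> A then i v else x v)" using i by auto
      ultimately show "i \<in> (\<Union>w\<in>T. ?S w)" by blast
    qed (use sub in \<open>auto simp: T_def\<close>)
    moreover have "disjoint_family_on ?S T"
      unfolding disjoint_family_on_def
    proof (intro ballI impI)
      fix w w' assume w: "w \<in> T" "w' \<in> T" "w \<noteq> w'"
      then obtain v where "w v \<noteq> w' v" by blast
      moreover from this have "v \<in> A" using w by (auto simp: T_def)
      ultimately show "?S w \<inter> ?S w' = {}" by force
    qed
    then have "measure (measure_pmf p) (\<Union>w\<in>T. ?S w) = (\<Sum>w\<in>T. measure (measure_pmf p) (?S w))"
      by (intro measure_pmf.finite_measure_finite_Union) auto
    ultimately show ?thesis by (simp add: cond_prob_def sum_divide_distrib)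
  qed
  have "\<P>(i in measure_pmf p. (\<forall>v\<in>A'. i v = x v) \<and> (\<forall>v\<in>B. i v = y v) \<bar> \<forall>v\<in>C. i v = z v) =
      (\<Sum>w\<in>T. \<P>(i in measure_pmf p. \<forall>v\<in>A. i v = w v \<bar> \<forall>v\<in>C. i v = z v)) *
      \<P>(i in measure_pmf p. \<forall>v\<in>B. i v = y v \<bar> \<forall>v\<in>C. i v = z v)"
    unfolding split sum_distrib_right
    by (intro sum.cong refl) (use ci pos in \<open>auto simp: cond_indep_def\<close>)
  then show "\<P>(i in measure_pmf p. (\<forall>v\<in>A'. i v = x v) \<and> (\<forall>v\<in>B. i v = y v) \<bar> \<forall>v\<in>C. i v = z v) =
      \<P>(i in measure_pmf p. \<forall>v\<in>A'. i v = x v \<bar> \<forall>v\<in>C. i v = z v) *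
      \<P>(i in measure_pmf p. \<forall>v\<in>B. i v = y v \<bar> \<forall>v\<in>C. i v = z v)"
    using split[of "\<lambda>_. True"] by simp
qed

lemma quotient_UNIV: "UNIV // r = {r `` {x} | x. True}"
  unfolding quotient_def by blast

lemma rtrancl_lines_G: "(lines G)\<^sup>* = Id \<union> {2, 3, 4} \<times> {2, 3, 4}" (is "_ = ?R")
proof
  show "(lines G)\<^sup>* \<subseteq> ?R"
  proof (rule subrelI)
    fix x y assume "(x, y) \<in> (lines G)\<^sup>*"
    then show "(x, y) \<in> ?R"
    proof (induction rule: rtrancl_induct)
      case (step y z)
      have "(y, z) \<in> {2, 3, 4} \<times> {2, 3, 4}" using step.hyps(2) by (auto simp: G_def)
      then show ?case using step.IH by blast
    qed simp
  qed
  have e: "(2, 3) \<in> (lines G)\<^sup>*" "(3, 2) \<in> (lines G)\<^sup>*" "(3, 4) \<in> (lines G)\<^sup>*" "(4, 3) \<in> (lines G)\<^sup>*"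
    by (rule r_into_rtrancl, simp add: G_def)+
  have e': "(2, 4) \<in> (lines G)\<^sup>*" "(4, 2) \<in> (lines G)\<^sup>*"
    by (rule rtrancl_trans[OF e(1,3)], rule rtrancl_trans[OF e(4,2)])
  have "(x, y) \<in> (lines G)\<^sup>*" if "x \<in> {2, 3, 4}" "y \<in> {2, 3, 4}" for x y
    using that by (elim insertE emptyE) (simp_all only: e e' rtrancl.rtrancl_refl)
  then show "?R \<subseteq> (lines G)\<^sup>*" by blast
qed

lemma chain_components_G: "chain_components G = {{1}, {2, 3, 4}}"
proof -
  have "chain_components G = (\<lambda>x. (lines G)\<^sup>* `` {x}) ` {1, 2, 3, 4}"
    unfolding chain_components_def quotient_UNIV UNIV_4 [symmetric] by auto
  also have "\<dots> = {{1}, {2, 3, 4}}"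
    unfolding rtrancl_lines_G by (auto simp: Image_def)
  finally show ?thesis .
qed

lemma chain_components_G_sing: "chain_components G_sing = {{1}, {2}, {3}, {4}}"
proof -
  have "chain_components G_sing = (\<lambda>x. {x}) ` {1, 2, 3, 4}"
    unfolding chain_components_def quotient_UNIV UNIV_4 [symmetric]
    by (auto simp: G_sing_def G_def)
  then show ?thesis by simp
qed

lemma component_arrows_G: "component_arrows G = {({1}, {2, 3, 4})}"
  by (auto simp: component_arrows_def chain_components_G) (auto simp: G_def)

lemma component_arrows_G_sing: "component_arrows G_sing = {({1}, {3})}"
  by (auto simp: component_arrows_def chain_components_G_sing) (auto simp: G_sing_def G_def)

lemma chain_graph_G: "chain_graph G"
  unfolding chain_graph_def component_arrows_G
  by (auto simp: G_def sym_def irrefl_def acyclic_def trancl_insert)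

lemma chain_graph_G_sing: "chain_graph G_sing"
  unfolding chain_graph_def component_arrows_G_sing
  by (auto simp: G_sing_def G_def sym_def irrefl_def acyclic_def trancl_insert)

lemma model_II_G:
  "model_II G = {p :: (4 \<Rightarrow> 's::finite) pmf. p \<in> positive_pmfs \<and>
     cond_indep p {2} {4} {1, 3} \<and> cond_indep p {1} {2, 4} {}}"
proof -
  have pc: "pa_comp G {1} = {}" "pa_comp G {2, 3, 4} = {1}"
    by (auto simp: pa_comp_def component_arrows_G)
  have pa: "pa G \<sigma> = (if 3 \<in> \<sigma> then {1} else {})" for \<sigma>
    by (auto simp: pa_def G_def)
  have nb: "nb G {2} = {3}" "nb G {4} = {3}" "nb G {2, 4} = {3}"
    by (auto simp: nb_def G_def)
  have nb3: "{2, 4} - \<sigma> \<subseteq> nb G \<sigma>" if "3 \<in> \<sigma>" for \<sigma>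
    using that by (auto simp: nb_def G_def)
  have s: "{2} \<subseteq> {2, 3, 4 :: 4}" "{2, 4} \<subseteq> {2, 3, 4 :: 4}" by auto
  have d: "{2, 3, 4} - ({3} \<union> {2}) = {4 :: 4}" "{2, 3, 4} - ({3} \<union> {4}) = {2 :: 4}"
    by auto
  have "markov_C1 G p" for p :: "(4 \<Rightarrow> 's) pmf"
  proof -
    have "nd_comp G {1} = {}" "nd_comp G {2, 3, 4} \<subseteq> {1}"
      by (auto simp: nd_comp_def chain_components_G component_arrows_G)
    then have e: "nd_comp G {1} - {} = {}" "nd_comp G {2, 3, 4} - {1} = {}" by auto
    show ?thesis unfolding markov_C1_def chain_components_G
      by (intro ballI, elim insertE emptyE) (simp_all only: pc e cond_indep_empty)
  qed
  moreover have "markov_C2a G p \<longleftrightarrow> cond_indep p {2} {4} {1, 3}" for p :: "(4 \<Rightarrow> 's) pmf"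
  proof
    assume "markov_C2a G p"
    then have "cond_indep p {2} ({2, 3, 4} - (nb G {2} \<union> {2})) (pa_comp G {2, 3, 4} \<union> nb G {2})"
      unfolding markov_C2a_def chain_components_G by (meson insertI1 insertI2 s)
    then show "cond_indep p {2} {4} {1, 3}"
      unfolding nb pc d by (simp only: Un_insert_left Un_empty_left)
  next
    assume ci: "cond_indep p {2} {4} {1, 3}"
    have "cond_indep p \<sigma> ({1} - (nb G \<sigma> \<union> \<sigma>)) (pa_comp G {1} \<union> nb G \<sigma>)" if "\<sigma> \<subseteq> {1}" for \<sigma>
    proof -
      from that have "\<sigma> = {} \<or> {1} - (nb G \<sigma> \<union> \<sigma>) = {}" by blast
      then show ?thesis by (elim disjE) (simp_all only: cond_indep_empty)
    qed
    moreover have "cond_indep p \<sigma> ({2, 3, 4} - (nb G \<sigma> \<union> \<sigma>)) (pa_comp G {2, 3, 4} \<union> nb G \<sigma>)"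
      if \<sigma>: "\<sigma> \<subseteq> {2, 3, 4}" for \<sigma>
    proof (cases "3 \<in> \<sigma>")
      case True
      then have "{2, 3, 4} - (nb G \<sigma> \<union> \<sigma>) = {}" using nb3[OF True] by blast
      then show ?thesis by (simp only: cond_indep_empty)
    next
      case False
      with \<sigma> have "\<sigma> \<subseteq> {2, 4}" by blast
      then have "\<sigma> = {} \<or> \<sigma> = {2} \<or> \<sigma> = {4} \<or> \<sigma> = {2, 4}"
        by (cases "2 \<in> \<sigma>"; cases "4 \<in> \<sigma>"; blast)
      then consider "\<sigma> = {}" | "\<sigma> = {2}" | "\<sigma> = {4}" | "\<sigma> = {2, 4}" by blast
      then show ?thesis
      proof cases
        case 2
        show ?thesis unfolding 2 nb pc d using ci by (simp only: Un_insert_left Un_empty_left)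
      next
        case 3
        show ?thesis unfolding 3 nb pc d using ci
          by (subst cond_indep_commute) (simp only: Un_insert_left Un_empty_left)
      next
        case 4
        have "{2, 3, 4} - ({3} \<union> {2, 4 :: 4}) = {}" by auto
        then show ?thesis unfolding 4 nb by (simp only: cond_indep_empty)
      qed simp
    qed
    ultimately show "markov_C2a G p" unfolding markov_C2a_def chain_components_G by blast
  qed
  moreover have "markov_C3b G p \<longleftrightarrow> cond_indep p {1} {2, 4} {}" for p :: "(4 \<Rightarrow> 's) pmf"
  proof
    assume "markov_C3b G p"
    then have "cond_indep p {2, 4} (pa_comp G {2, 3, 4} - pa G {2, 4}) (pa G {2, 4})"
      unfolding markov_C3b_def chain_components_G by (meson insertI1 insertI2 s)
    then show "cond_indep p {1} {2, 4} {}"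
      unfolding pa pc by (subst cond_indep_commute) simp
  next
    assume "cond_indep p {1} {2, 4} {}"
    then have ci: "cond_indep p {2, 4} {1} {}" by (subst cond_indep_commute)
    have "cond_indep p \<sigma> (pa_comp G {2, 3, 4} - pa G \<sigma>) (pa G \<sigma>)" if \<sigma>: "\<sigma> \<subseteq> {2, 3, 4}" for \<sigma>
    proof (cases "3 \<in> \<sigma>")
      case False
      with \<sigma> have "\<sigma> \<subseteq> {2, 4}" by blast
      from cond_indep_mono[OF ci this] show ?thesis using False by (simp only: pa pc if_False Diff_empty)
    qed (simp only: pa pc if_True Diff_cancel cond_indep_empty)
    then show "markov_C3b G p" unfolding markov_C3b_def chain_components_G by (simp add: pc)
  qed
  ultimately show ?thesis by (auto simp: model_II_def)
qed

lemma model_G_sing: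
  fixes p :: "(4 \<Rightarrow> 's::finite) pmf"
  defines "S \<equiv> p \<in> positive_pmfs \<and> cond_indep p {1} {2, 4} {} \<and> cond_indep p {2} {1, 3, 4} {} \<and>
     cond_indep p {4} {1, 2, 3} {} \<and> cond_indep p {3} {2, 4} {1}"
  shows "p \<in> model_II G_sing \<longleftrightarrow> S" and "p \<in> model_IV G_sing \<longleftrightarrow> S"
proof -
  have pc: "pa_comp G_sing {1} = {}" "pa_comp G_sing {2} = {}" "pa_comp G_sing {3} = {1}"
    "pa_comp G_sing {4} = {}"
    by (auto simp: pa_comp_def component_arrows_G_sing)
  have pa: "pa G_sing {3} = {1}"
    by (auto simp: pa_def G_sing_def G_def)
  have cl: "(component_arrows G_sing)\<^sup>* = insert ({1}, {3}) Id"
    by (auto simp: component_arrows_G_sing rtrancl_trancl_reflcl trancl_insert)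
  have "chain_components G_sing = range (\<lambda>v. {v})"
    by (simp add: chain_components_G_sing UNIV_4)
  then have nd: "nd_comp G_sing {u} = {v. v \<noteq> u \<and> \<not> (u = 1 \<and> v = 3)}" for u
    by (auto simp: nd_comp_def cl)
  have nd: "nd_comp G_sing {1} = {2, 4}" "nd_comp G_sing {2} = {1, 3, 4}"
    "nd_comp G_sing {3} = {1, 2, 4}" "nd_comp G_sing {4} = {1, 2, 3}"
    unfolding nd by (simp_all add: set_eq_iff forall_4)
  have d: "{1, 2, 4} - {1} = {2, 4 :: 4}" by auto
  have C1: "markov_C1 G_sing p \<longleftrightarrow> cond_indep p {1} {2, 4} {} \<and> cond_indep p {2} {1, 3, 4} {} \<and>
      cond_indep p {4} {1, 2, 3} {} \<and> cond_indep p {3} {2, 4} {1}"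
  proof -
    have "(\<forall>\<tau>\<in>{{1}, {2}, {3}, {4 :: 4}}. Q \<tau>) \<longleftrightarrow> Q {1} \<and> Q {2} \<and> Q {4} \<and> Q {3}" for Q
      by auto
    then show ?thesis
      unfolding markov_C1_def chain_components_G_sing by (simp only: pc nd d Diff_empty)
  qed
  have C2: "cond_indep p \<sigma> (\<tau> - (N \<union> \<sigma>)) C" if "\<tau> \<in> chain_components G_sing" "\<sigma> \<subseteq> \<tau>" for \<tau> \<sigma> N C
  proof -
    from that have "\<sigma> = {} \<or> \<tau> - (N \<union> \<sigma>) = {}" unfolding chain_components_G_sing by blast
    then show ?thesis by (elim disjE) (simp_all only: cond_indep_empty)
  qed
  have C3: "cond_indep p \<sigma> (pa_comp G_sing \<tau> - pa G_sing \<sigma>) (pa G_sing \<sigma>)"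
    if "\<tau> \<in> chain_components G_sing" "\<sigma> \<subseteq> \<tau>" for \<tau> \<sigma>
  proof -
    from that have "\<sigma> = {} \<or> \<sigma> = \<tau>" unfolding chain_components_G_sing by blast
    moreover have "pa_comp G_sing \<tau> - pa G_sing \<tau> = {}"
      using that(1) unfolding chain_components_G_sing by (auto simp: pc pa)
    ultimately show ?thesis by (elim disjE) (simp_all only: cond_indep_empty)
  qed
  have "markov_C2a G_sing p" "markov_C2b G_sing p" "markov_C3b G_sing p"
    unfolding markov_C2a_def markov_C2b_def markov_C3b_def using C2 C3 by blast+
  then show "p \<in> model_II G_sing \<longleftrightarrow> S" and "p \<in> model_IV G_sing \<longleftrightarrow> S"
    by (auto simp: model_II_def model_IV_def S_def C1)
qed

end

theory Submission
  imports Defs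
begin

text \<open>Put \<open>u\<^sub>a = q\<^sub>2\<^sub>3\<^sub>|\<^sub>a - q\<^sub>3\<^sub>|\<^sub>a q\<^sub>2\<close>, \<open>v\<^sub>a = q\<^sub>3\<^sub>4\<^sub>|\<^sub>a - q\<^sub>3\<^sub>|\<^sub>a q\<^sub>4\<close> and
  \<open>w = q\<^sub>2\<^sub>4 - q\<^sub>2 q\<^sub>4\<close>. The equations of \<open>W\<close> say that \<open>q\<^sub>2\<^sub>3\<^sub>4\<^sub>|\<^sub>a\<close> is a polynomial in the other
  coordinates and that \<open>u\<^sub>a v\<^sub>a = q\<^sub>3\<^sub>|\<^sub>a (1 - q\<^sub>3\<^sub>|\<^sub>a) w\<close>. Near points with
  \<open>0 < q\<^sub>3\<^sub>|\<^sub>a < 1\<close> this is, up to scaling, the product of \<open>\<real>\<^sup>4\<close> and the cone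
  \<open>u\<^sub>1 v\<^sub>1 = u\<^sub>2 v\<^sub>2\<close>, which is singular only at its vertex; and \<open>u = v = 0\<close> means that
  \<open>(X\<^sub>1, X\<^sub>3)\<close>, \<open>X\<^sub>2\<close>, \<open>X\<^sub>4\<close> are independent.

  The local dimension is at most 7 because the functions of degree at most \<open>M\<close> on \<open>W\<close> span a
  space of dimension \<open>O(M\<^sup>7)\<close>, while a chain of \<open>n + 1\<close> irreducible closed sets yields \<open>n\<close>
  algebraically independent functions. Away from the vertex a polynomial map from \<open>\<real>\<^sup>7\<close> with a
  polynomial inverse up to nonvanishing factors gives the reverse inequality.\<close>

section \<open>Chains of irreducible sets and algebraic independence\<close>

text \<open>The zero sets of \<open>f\<close> and \<open>g\<close> in \<open>Z\<close> are closed
  and together cover \<open>Z\<close>, so one of them is all of \<open>Z\<close>: polynomial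
  functions on an irreducible set have no zero divisors.\<close>

lemma irreducible_zariski_mult_eq_0:
  assumes irr: "irreducible_space (subtopology zariski Z)"
    and f: "real_polynomial_function f" and g: "real_polynomial_function g"
    and fg: "\<And>x. x \<in> Z \<Longrightarrow> f x * g x = 0"
  shows "(\<forall>x\<in>Z. f x = 0) \<or> (\<forall>x\<in>Z. g x = 0)"
proof -
  have cl: "closedin (subtopology zariski Z) ({x. h x = 0} \<inter> Z)" if "real_polynomial_function h" for h
  proof -
    have "algebraic_set {x. h x = 0}"
      unfolding algebraic_set_def by (rule exI[of _ "{h}"]) (use that in auto)
    then show ?thesis
      unfolding closedin_subtopology closedin_zariski by blast
  qed
  have "{x. f x = 0} \<inter> Z \<union> {x. g x = 0} \<inter> Z = topspace (subtopology zariski Z)"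
    using fg by auto
  with irr cl[OF f] cl[OF g] have "{x. f x = 0} \<inter> Z = Z \<or> {x. g x = 0} \<inter> Z = Z"
    unfolding irreducible_space_def by auto
  then show ?thesis by blast
qed

text \<open>Exponents are taken in \<open>extensional {..<n}\<close> so that two of them agreeing
  below \<open>n\<close> are equal; otherwise one monomial could occur twice with opposite
  coefficients.\<close>

definition alg_indep_on :: "'a set \<Rightarrow> nat \<Rightarrow> (nat \<Rightarrow> 'a \<Rightarrow> real) \<Rightarrow> bool" where
  "alg_indep_on Z n f \<longleftrightarrow> (\<forall>A c. finite A \<and> A \<subseteq> extensional {..<n} \<and>
     (\<forall>x\<in>Z. (\<Sum>\<alpha>\<in>A. c \<alpha> * (\<Prod>i<n. f i x ^ \<alpha> i)) = 0) \<longrightarrow> (\<forall>\<alpha>\<in>A. c \<alpha> = 0))"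

lemma alg_indep_on_mono:
  assumes "alg_indep_on Z n f" "Z \<subseteq> Z'"
  shows "alg_indep_on Z' n f"
  unfolding alg_indep_on_def
proof (intro allI impI, elim conjE)
  fix A :: "(nat \<Rightarrow> nat) set" and c :: "(nat \<Rightarrow> nat) \<Rightarrow> real"
  assume "finite A" "A \<subseteq> extensional {..<n}"
    and "\<forall>x\<in>Z'. (\<Sum>\<alpha>\<in>A. c \<alpha> * (\<Prod>i<n. f i x ^ \<alpha> i)) = 0"
  moreover from this(3) have "\<forall>x\<in>Z. (\<Sum>\<alpha>\<in>A. c \<alpha> * (\<Prod>i<n. f i x ^ \<alpha> i)) = 0"
    using assms(2) by blast
  ultimately show "\<forall>\<alpha>\<in>A. c \<alpha> = 0" using assms(1) unfolding alg_indep_on_def by simp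
qed

lemma real_polynomial_function_prod_power:
  assumes "finite I" "\<And>i. i \<in> I \<Longrightarrow> real_polynomial_function (f i)"
  shows "real_polynomial_function (\<lambda>x. \<Prod>i\<in>I. f i x ^ \<alpha> i)"
  using assms by (intro real_polynomial_function_prod real_polynomial_function_power) auto

text \<open>Dividing a relation by the largest possible power of \<open>h\<close> and restricting it to \<open>Z\<close> gives
  a relation between the \<open>f\<^sub>i\<close> on \<open>Z\<close>.\<close>

lemma alg_indep_on_extend:
  assumes irr: "irreducible_space (subtopology zariski Z')" and sub: "Z \<subseteq> Z'"
    and f: "\<And>i. i < n \<Longrightarrow> real_polynomial_function (f i)" and h: "real_polynomial_function h"
    and h0: "\<And>x. x \<in> Z \<Longrightarrow> h x = 0" and x0: "x0 \<in> Z'" "h x0 \<noteq> 0"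
    and ind: "alg_indep_on Z n f"
  shows "alg_indep_on Z' (Suc n) (f(n := h))"
  unfolding alg_indep_on_def
proof (intro allI impI, elim conjE)
  fix A :: "(nat \<Rightarrow> nat) set" and c :: "(nat \<Rightarrow> nat) \<Rightarrow> real"
  assume fin: "finite A" and ext: "A \<subseteq> extensional {..<Suc n}"
    and rel: "\<forall>x\<in>Z'. (\<Sum>\<alpha>\<in>A. c \<alpha> * (\<Prod>i<Suc n. (f(n := h)) i x ^ \<alpha> i)) = 0"
  define mon where "mon \<alpha> x = (\<Prod>i<n. f i x ^ \<alpha> i)" for \<alpha> x
  have mon: "(\<Prod>i<Suc n. (f(n := h)) i x ^ \<alpha> i) = mon \<alpha> x * h x ^ \<alpha> n" for \<alpha> x
    by (simp add: mon_def)
  show "\<forall>\<alpha>\<in>A. c \<alpha> = 0"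
  proof (rule ccontr)
    assume nz: "\<not> (\<forall>\<alpha>\<in>A. c \<alpha> = 0)"
    \<comment> \<open>Terms with coefficient 0 are dropped, so that \<open>k\<close> is the exact
      power of \<open>h\<close> common to the terms really present.\<close>
    define A' where "A' = {\<alpha>\<in>A. c \<alpha> \<noteq> 0}"
    have A': "finite A'" "A' \<noteq> {}" "A' \<subseteq> A" using fin nz by (auto simp: A'_def)
    define k where "k = Min ((\<lambda>\<alpha>. \<alpha> n) ` A')"
    have kle: "k \<le> \<alpha> n" if "\<alpha> \<in> A'" for \<alpha>
      using that A' by (auto simp: k_def)
    have "k \<in> (\<lambda>\<alpha>. \<alpha> n) ` A'" unfolding k_def by (rule Min_in) (use A' in auto)
    then obtain \<alpha>0 where \<alpha>0: "\<alpha>0 \<in> A'" "\<alpha>0 n = k" by blast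
    define R where "R x = (\<Sum>\<alpha>\<in>A'. c \<alpha> * (mon \<alpha> x * h x ^ (\<alpha> n - k)))" for x
    have polyR: "real_polynomial_function R"
      unfolding R_def mon_def using A' h f
      by (intro real_polynomial_function_sum real_polynomial_function.intros(2,4)
        real_polynomial_function_power real_polynomial_function_prod_power) auto
    have "h x ^ k * R x = 0" if "x \<in> Z'" for x
    proof -
      have "h x ^ k * R x = (\<Sum>\<alpha>\<in>A'. c \<alpha> * (mon \<alpha> x * h x ^ \<alpha> n))"
        unfolding R_def sum_distrib_left
      proof (rule sum.cong)
        fix \<alpha> assume "\<alpha> \<in> A'"
        then have "h x ^ \<alpha> n = h x ^ k * h x ^ (\<alpha> n - k)"
          using kle by (simp flip: power_add)
        then show "h x ^ k * (c \<alpha> * (mon \<alpha> x * h x ^ (\<alpha> n - k))) = c \<alpha> * (mon \<alpha> x * h x ^ \<alpha> n)"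
          by simp
      qed simp
      also have "\<dots> = (\<Sum>\<alpha>\<in>A. c \<alpha> * (mon \<alpha> x * h x ^ \<alpha> n))"
        by (rule sum.mono_neutral_left) (use fin A'_def in auto)
      also have "\<dots> = 0" using rel that unfolding mon by blast
      finally show ?thesis .
    qed
    then have "(\<forall>x\<in>Z'. h x ^ k = 0) \<or> (\<forall>x\<in>Z'. R x = 0)"
      using irreducible_zariski_mult_eq_0[OF irr real_polynomial_function_power[OF h] polyR] by blast
    then have R0: "\<forall>x\<in>Z'. R x = 0" using x0 by auto
    \<comment> \<open>Only terms in which \<open>h\<close> has exponent exactly \<open>k\<close>
      survive on \<open>Z\<close>. As they share this last exponent, they stay distinct after
      truncation to the first \<open>n\<close> exponents.\<close>
    define B where "B = {\<alpha>\<in>A'. \<alpha> n = k}"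
    define r where "r \<alpha> = restrict \<alpha> {..<n}" for \<alpha> :: "nat \<Rightarrow> nat"
    have inj: "inj_on r B"
    proof (rule inj_onI)
      fix \<alpha> \<beta> assume ab: "\<alpha> \<in> B" "\<beta> \<in> B" "r \<alpha> = r \<beta>"
      have "\<alpha> \<in> extensional {..<Suc n}" "\<beta> \<in> extensional {..<Suc n}"
        using ab A'(3) ext by (auto simp: B_def)
      moreover have "\<alpha> i = \<beta> i" if "i < Suc n" for i
      proof (cases "i = n")
        case False
        with that have "r \<alpha> i = \<alpha> i" "r \<beta> i = \<beta> i" by (auto simp: r_def)
        with ab show ?thesis by simp
      qed (use ab in \<open>auto simp: B_def\<close>)
      ultimately show "\<alpha> = \<beta>" by (auto intro: extensionalityI)
    qed
    define c' where "c' = c \<circ> inv_into B r"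
    have "finite (r ` B) \<and> r ` B \<subseteq> extensional {..<n} \<and>
       (\<forall>x\<in>Z. (\<Sum>\<alpha>\<in>r ` B. c' \<alpha> * (\<Prod>i<n. f i x ^ \<alpha> i)) = 0)"
    proof (intro conjI ballI)
      show "finite (r ` B)" using A' by (simp add: B_def)
      show "r ` B \<subseteq> extensional {..<n}" by (auto simp: r_def)
      fix x assume x: "x \<in> Z"
      have "(\<Sum>\<alpha>\<in>r ` B. c' \<alpha> * (\<Prod>i<n. f i x ^ \<alpha> i)) = (\<Sum>\<alpha>\<in>B. c \<alpha> * mon \<alpha> x)"
        unfolding sum.reindex[OF inj]
      proof (rule sum.cong)
        fix \<alpha> assume "\<alpha> \<in> B"
        then have "c' (r \<alpha>) = c \<alpha>" by (simp add: c'_def inv_into_f_f[OF inj])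
        then show "((\<lambda>\<alpha>. c' \<alpha> * (\<Prod>i<n. f i x ^ \<alpha> i)) \<circ> r) \<alpha> = c \<alpha> * mon \<alpha> x"
          by (simp add: mon_def r_def)
      qed simp
      also have "\<dots> = R x"
        unfolding R_def
        by (rule sum.mono_neutral_cong_left) (use A' kle h0[OF x] in \<open>auto simp: B_def le_less\<close>)
      also have "\<dots> = 0" using R0 x sub by blast
      finally show "(\<Sum>\<alpha>\<in>r ` B. c' \<alpha> * (\<Prod>i<n. f i x ^ \<alpha> i)) = 0" .
    qed
    then have "\<forall>\<alpha>\<in>r ` B. c' \<alpha> = 0"
      using ind unfolding alg_indep_on_def by blast
    moreover have "\<alpha>0 \<in> B" using \<alpha>0 by (simp add: B_def)
    ultimately have "c \<alpha>0 = 0" by (auto simp: c'_def inv_into_f_f[OF inj])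
    then show False using \<alpha>0 by (simp add: A'_def)
  qed
qed

text \<open>Each strict step of the chain contributes one new function: as \<open>Z n\<close> is
  closed and properly contained in \<open>Z (Suc n)\<close>, one of its equations fails somewhere on
  \<open>Z (Suc n)\<close>.\<close>

lemma alg_indep_on_chain:
  fixes Z :: "nat \<Rightarrow> 'a::euclidean_space set"
  assumes cl: "\<And>k. k \<le> n \<Longrightarrow> closedin (subtopology zariski V) (Z k)"
    and irr: "\<And>k. k \<le> n \<Longrightarrow> irreducible_space (subtopology zariski (Z k))"
    and strict: "\<And>k. k < n \<Longrightarrow> Z k \<subset> Z (Suc k)"
  shows "\<exists>f. (\<forall>i<n. real_polynomial_function (f i)) \<and> alg_indep_on (Z n) n f"
  using assms
proof (induction n)
  case 0
  have "irreducible_space (subtopology zariski (Z 0))" by (rule 0) simp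
  then have "Z 0 \<noteq> {}" by (simp add: irreducible_space_def)
  have "alg_indep_on (Z 0) 0 (\<lambda>_ _. 0)"
    unfolding alg_indep_on_def
  proof (intro allI impI, elim conjE)
    fix A :: "(nat \<Rightarrow> nat) set" and c :: "(nat \<Rightarrow> nat) \<Rightarrow> real"
    assume *: "A \<subseteq> extensional {..<0}" "\<forall>x\<in>Z 0. (\<Sum>\<alpha>\<in>A. c \<alpha> * (\<Prod>i<0. 0 ^ \<alpha> i)) = 0"
    from \<open>Z 0 \<noteq> {}\<close> obtain x where "x \<in> Z 0" by blast
    with *(2) have "(\<Sum>\<alpha>\<in>A. c \<alpha>) = 0" by auto
    \<comment> \<open>Without variables there is a single exponent, whose monomial is the empty
      product 1.\<close>
    moreover have "A = {} \<or> A = {\<lambda>_. undefined}" using *(1) by (simp add: subset_singleton_iff)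
    ultimately show "\<forall>\<alpha>\<in>A. c \<alpha> = 0" by (elim disjE) simp_all
  qed
  then show ?case by (intro exI[of _ "\<lambda>_ _. 0"]) simp
next
  case (Suc n)
  have "\<exists>f. (\<forall>i<n. real_polynomial_function (f i)) \<and> alg_indep_on (Z n) n f"
    by (rule Suc.IH) (use Suc.prems in auto)
  then obtain f where f: "\<forall>i<n. real_polynomial_function (f i)" "alg_indep_on (Z n) n f" by blast
  have psub: "Z n \<subset> Z (Suc n)" using Suc.prems(3) by simp
  obtain F where F: "\<forall>f\<in>F. real_polynomial_function f" "Z n = {x. \<forall>f\<in>F. f x = 0} \<inter> V"
    using Suc.prems(1)[of n]
    unfolding closedin_subtopology closedin_zariski algebraic_set_def by auto
  have "Z (Suc n) \<subseteq> V" using closedin_subset[OF Suc.prems(1)[of "Suc n"]] by simp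
  with psub F obtain x0 h where x0: "x0 \<in> Z (Suc n)" "h \<in> F" "h x0 \<noteq> 0" by blast
  have "alg_indep_on (Z (Suc n)) (Suc n) (f(n := h))"
    by (rule alg_indep_on_extend[of _ "Z n"]) (use Suc.prems(2) psub f F x0 in auto)
  moreover have "\<forall>i<Suc n. real_polynomial_function ((f(n := h)) i)"
    using f F x0 by (auto simp: less_Suc_eq)
  ultimately show ?case by blast
qed

text \<open>A chain that is too long is cut off at index \<open>Suc d\<close>; functions independent
  on \<open>Z (Suc d)\<close> stay independent on the larger set \<open>V\<close>.\<close>

lemma krull_dim_le_if_alg_dep:
  fixes V :: "'a::euclidean_space set"
  assumes dep: "\<And>f. (\<And>i. i < Suc d \<Longrightarrow> real_polynomial_function (f i)) \<Longrightarrow> \<not> alg_indep_on V (Suc d) f"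
  shows "krull_dim (subtopology zariski V) \<le> enat d"
  unfolding krull_dim_def
proof (rule Sup_least, clarify)
  fix n and Z :: "nat \<Rightarrow> 'a set"
  assume Z: "\<forall>k\<le>n. closedin (subtopology zariski V) (Z k) \<and>
      irreducible_space (subtopology (subtopology zariski V) (Z k))"
    and strict: "\<forall>k<n. Z k \<subset> Z (Suc k)"
  have sub: "Z k \<subseteq> V" if "k \<le> n" for k
    using Z that closedin_subset[of "subtopology zariski V" "Z k"] by simp
  have irr: "irreducible_space (subtopology zariski (Z k))" if "k \<le> n" for k
  proof -
    have "irreducible_space (subtopology zariski (V \<inter> Z k))"
      using Z that unfolding subtopology_subtopology by blast
    then show ?thesis by (simp only: Int_absorb1[OF sub[OF that]])
  qed
  show "enat n \<le> enat d"
  proof (rule ccontr)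
    assume "\<not> enat n \<le> enat d"
    then have n: "Suc d \<le> n" by simp
    have "\<exists>f. (\<forall>i<Suc d. real_polynomial_function (f i)) \<and> alg_indep_on (Z (Suc d)) (Suc d) f"
      by (rule alg_indep_on_chain[where V = V]) (use Z irr strict n in auto)
    then show False using dep alg_indep_on_mono[OF _ sub[OF n]] by blast
  qed
qed

lemma local_dim_le_krull_dim:
  assumes "x \<in> topspace X"
  shows "local_dim X x \<le> krull_dim X"
proof -
  have "krull_dim (subtopology X (topspace X)) \<in> {krull_dim (subtopology X U) | U. openin X U \<and> x \<in> U}"
    by (intro CollectI exI[of _ "topspace X"] conjI refl openin_topspace assms)
  then show ?thesis
    unfolding local_dim_def subtopology_topspace by (rule Inf_lower)
qed

section \<open>Growth of function spaces\<close>

text \<open>Gaussian elimination: the unknown \<open>k0\<close> serves as pivot for equation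
  \<open>j\<close>, the reduced system in the remaining unknowns is solved by induction, and back
  substitution gives the value at \<open>k0\<close>.\<close>

lemma homogeneous_system_nontrivial:
  fixes c :: "'k \<Rightarrow> 'j \<Rightarrow> real"
  assumes "finite J" "finite K" "card J < card K"
  shows "\<exists>l. (\<exists>k\<in>K. l k \<noteq> 0) \<and> (\<forall>j\<in>J. (\<Sum>k\<in>K. l k * c k j) = 0)"
  using assms
proof (induction J arbitrary: K c rule: finite_induct)
  case empty
  then have "K \<noteq> {}" by auto
  then show ?case by (intro exI[of _ "\<lambda>_. 1"]) auto
next
  case (insert j J)
  show ?case
  proof (cases "\<forall>k\<in>K. c k j = 0")
    case True
    have "card J < card K" using insert by simp
    from insert.IH[OF insert.prems(1) this, of c] True show ?thesis by auto
  next
    case False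
    then obtain k0 where k0: "k0 \<in> K" "c k0 j \<noteq> 0" by blast
    define K' where "K' = K - {k0}"
    have "finite K'" "card J < card K'" using insert k0 by (auto simp: K'_def)
    from insert.IH[OF this, of "\<lambda>k i. c k i - c k j / c k0 j * c k0 i"]
    obtain l where l: "\<exists>k\<in>K'. l k \<noteq> 0"
      "\<forall>i\<in>J. (\<Sum>k\<in>K'. l k * (c k i - c k j / c k0 j * c k0 i)) = 0" by blast
    define s where "s = (\<Sum>k\<in>K'. l k * c k j)"
    define l' where "l' = l(k0 := - s / c k0 j)"
    have sum: "(\<Sum>k\<in>K. l' k * c k i) = (\<Sum>k\<in>K'. l k * c k i) - s / c k0 j * c k0 i" for i
    proof -
      have "(\<Sum>k\<in>K. l' k * c k i) = l' k0 * c k0 i + (\<Sum>k\<in>K'. l' k * c k i)"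
        unfolding K'_def by (rule sum.remove) (use insert k0 in auto)
      also have "(\<Sum>k\<in>K'. l' k * c k i) = (\<Sum>k\<in>K'. l k * c k i)"
        by (rule sum.cong) (auto simp: l'_def K'_def)
      finally show ?thesis by (simp add: l'_def)
    qed
    have "(\<Sum>k\<in>K. l' k * c k i) = 0" if "i \<in> insert j J" for i
    proof (cases "i = j")
      case False
      with that have "(\<Sum>k\<in>K'. l k * (c k i - c k j / c k0 j * c k0 i)) = 0" using l by blast
      moreover have "(\<Sum>k\<in>K'. l k * (c k i - c k j / c k0 j * c k0 i)) =
          (\<Sum>k\<in>K'. l k * c k i) - s / c k0 j * c k0 i"
        by (simp add: s_def sum_divide_distrib sum_distrib_right sum_subtractf right_diff_distrib mult.assoc)
      ultimately show ?thesis unfolding sum by simp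
    qed (use k0 in \<open>simp add: sum, simp add: s_def\<close>)
    moreover have "\<exists>k\<in>K. l' k \<noteq> 0" using l by (auto simp: l'_def K'_def)
    ultimately show ?thesis by blast
  qed
qed

text \<open>\<open>J M\<close> indexes the generators of level at most \<open>M\<close> of an
  increasing filtration of functions on \<open>V\<close>. The \<open>b j\<close> may be dependent:
  only an upper bound on dimensions is sought, and \<open>card (J M)\<close> provides it.\<close>

locale filtered_functions =
  fixes V :: "'a::euclidean_space set" and J :: "nat \<Rightarrow> 'j set" and b :: "'j \<Rightarrow> 'a \<Rightarrow> real"
  assumes finite_J: "finite (J M)" and mono_J: "M \<le> N \<Longrightarrow> J M \<subseteq> J N"
begin

definition spanned :: "nat \<Rightarrow> ('a \<Rightarrow> real) \<Rightarrow> bool" where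
  "spanned M g \<longleftrightarrow> (\<exists>c. \<forall>x\<in>V. g x = (\<Sum>j\<in>J M. c j * b j x))"

text \<open>A substitute for "\<open>f\<close> has degree at most \<open>N\<close> on
  \<open>V\<close>", phrased through multiplication so that shifts add up under products.\<close>

definition bounded_shift :: "('a \<Rightarrow> real) \<Rightarrow> nat \<Rightarrow> bool" where
  "bounded_shift f N \<longleftrightarrow> (\<forall>M g. spanned M g \<longrightarrow> spanned (M + N) (\<lambda>x. f x * g x))"

section \<open>Calculus of spans and degree shifts\<close>

lemma spanned_cong: "spanned M g \<Longrightarrow> (\<And>x. x \<in> V \<Longrightarrow> g x = h x) \<Longrightarrow> spanned M h"
  unfolding spanned_def by auto

lemma spanned_mono:
  assumes "spanned M g" "M \<le> N"
  shows "spanned N g"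
proof -
  from assms obtain c where c: "\<forall>x\<in>V. g x = (\<Sum>j\<in>J M. c j * b j x)" unfolding spanned_def by blast
  have "g x = (\<Sum>j\<in>J N. (if j \<in> J M then c j else 0) * b j x)" if "x \<in> V" for x
    using c that mono_J[OF assms(2)] finite_J
    by (auto intro!: sum.mono_neutral_cong_left)
  then show ?thesis unfolding spanned_def by (intro exI[of _ "\<lambda>j. if j \<in> J M then c j else 0"]) blast
qed

lemma spanned_base:
  assumes "j \<in> J M"
  shows "spanned M (b j)"
  unfolding spanned_def
proof (intro exI ballI)
  fix x
  show "b j x = (\<Sum>i\<in>J M. (if i = j then 1 else 0) * b i x)"
    using assms finite_J by (simp add: if_distrib[of "\<lambda>c. c * _"] sum.delta' cong: if_cong)
qed

lemma spanned_add: "spanned M g \<Longrightarrow> spanned M h \<Longrightarrow> spanned M (\<lambda>x. g x + h x)"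
  unfolding spanned_def
proof (elim exE)
  fix c d
  assume "\<forall>x\<in>V. g x = (\<Sum>j\<in>J M. c j * b j x)" "\<forall>x\<in>V. h x = (\<Sum>j\<in>J M. d j * b j x)"
  then show "\<exists>c. \<forall>x\<in>V. g x + h x = (\<Sum>j\<in>J M. c j * b j x)"
    by (intro exI[of _ "\<lambda>j. c j + d j"]) (simp add: distrib_right sum.distrib)
qed

lemma spanned_scale: "spanned M g \<Longrightarrow> spanned M (\<lambda>x. r * g x)"
  unfolding spanned_def
proof (elim exE)
  fix c
  assume "\<forall>x\<in>V. g x = (\<Sum>j\<in>J M. c j * b j x)"
  then show "\<exists>c. \<forall>x\<in>V. r * g x = (\<Sum>j\<in>J M. c j * b j x)"
    by (intro exI[of _ "\<lambda>j. r * c j"]) (simp add: sum_distrib_left mult.assoc)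
qed

lemma spanned_sum:
  assumes "finite I" "\<And>i. i \<in> I \<Longrightarrow> spanned M (g i)"
  shows "spanned M (\<lambda>x. \<Sum>i\<in>I. g i x)"
  using assms
proof (induction I rule: finite_induct)
  case empty
  show ?case unfolding spanned_def by (intro exI[of _ "\<lambda>_. 0"]) simp
next
  case (insert i I)
  then show ?case using spanned_add[of M "g i"] by simp
qed

lemma bounded_shiftD: "bounded_shift f N \<Longrightarrow> spanned M g \<Longrightarrow> spanned (M + N) (\<lambda>x. f x * g x)"
  unfolding bounded_shift_def by simp

lemma bounded_shift_mono:
  assumes "bounded_shift f N" "N \<le> N'"
  shows "bounded_shift f N'"
  unfolding bounded_shift_def
proof (intro allI impI)
  fix M g assume "spanned M g"
  from bounded_shiftD[OF assms(1) this] show "spanned (M + N') (\<lambda>x. f x * g x)"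
    by (rule spanned_mono) (simp add: assms(2))
qed

lemma bounded_shift_cong:
  assumes "bounded_shift f N" "\<And>x. x \<in> V \<Longrightarrow> f x = h x"
  shows "bounded_shift h N"
  unfolding bounded_shift_def
proof (intro allI impI)
  fix M g assume "spanned M g"
  with assms(1) have "spanned (M + N) (\<lambda>x. f x * g x)" unfolding bounded_shift_def by blast
  then show "spanned (M + N) (\<lambda>x. h x * g x)" by (rule spanned_cong) (simp add: assms(2))
qed

lemma bounded_shift_const: "bounded_shift (\<lambda>_. r) 0"
  unfolding bounded_shift_def using spanned_scale by simp

lemma bounded_shift_add:
  assumes "bounded_shift f N" "bounded_shift g N'"
  shows "bounded_shift (\<lambda>x. f x + g x) (max N N')"
proof -
  have *: "bounded_shift f (max N N')" "bounded_shift g (max N N')"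
    by (rule bounded_shift_mono[OF assms(1)], simp, rule bounded_shift_mono[OF assms(2)], simp)
  show ?thesis
    unfolding bounded_shift_def distrib_right
    by (intro allI impI spanned_add bounded_shiftD[OF *(1)] bounded_shiftD[OF *(2)])
qed

lemma bounded_shift_mult:
  assumes "bounded_shift f N" "bounded_shift g N'"
  shows "bounded_shift (\<lambda>x. f x * g x) (N + N')"
  unfolding bounded_shift_def
proof (intro allI impI)
  fix M h assume "spanned M h"
  from bounded_shiftD[OF assms(1) bounded_shiftD[OF assms(2) this]]
  have "spanned (M + N' + N) (\<lambda>x. f x * (g x * h x))" .
  then show "spanned (M + (N + N')) (\<lambda>x. f x * g x * h x)" by (simp add: ac_simps)
qed

lemma bounded_shift_power:
  assumes "bounded_shift f N"
  shows "bounded_shift (\<lambda>x. f x ^ k) (k * N)"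
proof (induction k)
  case 0
  show ?case using bounded_shift_const[of 1] by simp
next
  case (Suc k)
  from bounded_shift_mult[OF assms Suc] show ?case by simp
qed

lemma bounded_shift_prod:
  assumes "finite I" "\<And>i. i \<in> I \<Longrightarrow> bounded_shift (f i) (N i)"
  shows "bounded_shift (\<lambda>x. \<Prod>i\<in>I. f i x) (\<Sum>i\<in>I. N i)"
  using assms
proof (induction I rule: finite_induct)
  case empty
  show ?case using bounded_shift_const[of 1] by simp
next
  case (insert i I)
  have "bounded_shift (f i) (N i)" "bounded_shift (\<lambda>x. \<Prod>i\<in>I. f i x) (\<Sum>i\<in>I. N i)"
    using insert by simp_all
  from bounded_shift_mult[OF this] show ?case using insert.hyps by simp
qed

text \<open>Multiplication by \<open>f\<close> is linear, so its effect on generators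
  decides.\<close>

lemma bounded_shift_if_base:
  assumes "\<And>M j. j \<in> J M \<Longrightarrow> spanned (M + N) (\<lambda>x. f x * b j x)"
  shows "bounded_shift f N"
  unfolding bounded_shift_def
proof (intro allI impI)
  fix M g assume "spanned M g"
  then obtain c where c: "\<forall>x\<in>V. g x = (\<Sum>j\<in>J M. c j * b j x)" unfolding spanned_def by blast
  have "spanned (M + N) (\<lambda>x. \<Sum>j\<in>J M. c j * (f x * b j x))"
    by (intro spanned_sum finite_J spanned_scale assms)
  then show "spanned (M + N) (\<lambda>x. f x * g x)"
    by (rule spanned_cong) (simp add: c sum_distrib_left ac_simps)
qed

text \<open>The functions with some bounded shift are closed under sums and products and contain the
  constants; once they contain the coordinates they contain all polynomials.\<close>

lemma bounded_shift_polynomial: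
  assumes coord: "\<And>e. e \<in> Basis \<Longrightarrow> \<exists>N. bounded_shift (\<lambda>x. x \<bullet> e) N"
    and "real_polynomial_function f"
  shows "\<exists>N. bounded_shift f N"
  using assms(2)
proof (induction rule: real_polynomial_function.induct)
  case (linear f)
  have "\<exists>N. bounded_shift (\<lambda>x. \<Sum>e\<in>I. f e * (x \<bullet> e)) N" if "finite I" "I \<subseteq> Basis" for I
    using that
  proof (induction I rule: finite_induct)
    case empty
    then show ?case using bounded_shift_const[of 0] by auto
  next
    case (insert e I)
    then obtain N' where N': "bounded_shift (\<lambda>x. \<Sum>e\<in>I. f e * (x \<bullet> e)) N'" by auto
    from insert.prems coord[of e] obtain N where N: "bounded_shift (\<lambda>x. x \<bullet> e) N" by auto
    from bounded_shift_add[OF bounded_shift_mult[OF bounded_shift_const N, of "f e"] N']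
    show ?case using insert.hyps by auto
  qed
  from this[of Basis] obtain N where N: "bounded_shift (\<lambda>x. \<Sum>e\<in>Basis. f e * (x \<bullet> e)) N" by auto
  have "(\<Sum>e\<in>Basis. f e * (x \<bullet> e)) = f x" for x
  proof -
    have "f x = f (\<Sum>e\<in>Basis. (x \<bullet> e) *\<^sub>R e)" by (simp add: euclidean_representation)
    also have "\<dots> = (\<Sum>e\<in>Basis. f e * (x \<bullet> e))"
      using linear by (simp add: linear_sum linear_scale bounded_linear.linear mult.commute)
    finally show ?thesis by simp
  qed
  with N show ?case by auto
next
  case (const c)
  show ?case by (rule exI, rule bounded_shift_const)
next
  case (add f g)
  then obtain N N' where "bounded_shift f N" "bounded_shift g N'" by (elim exE)
  then show ?case by (intro exI, rule bounded_shift_add)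
next
  case (mult f g)
  then obtain N N' where "bounded_shift f N" "bounded_shift g N'" by (elim exE)
  then show ?case by (intro exI, rule bounded_shift_mult)
qed

text \<open>The \<open>(m + 1)^(d + 1)\<close> monomials of degree at most \<open>m\<close> in each of \<open>d + 1\<close> functions lie in
  a space of dimension \<open>O(m^d)\<close>.\<close>

lemma alg_dep_if_growth:
  assumes poly: "\<And>i. i < Suc d \<Longrightarrow> bounded_shift (f i) N"
    and one: "spanned 0 (\<lambda>_. 1)"
    and card: "\<And>M. card (J M) \<le> (2 * M + 1) ^ d"
  shows "\<not> alg_indep_on V (Suc d) f"
proof
  assume ind: "alg_indep_on V (Suc d) f"
  \<comment> \<open>All monomials with exponents at most \<open>m\<close> lie in level
    \<open>M\<close>, and \<open>2 * M + 1 \<le> L * Suc m\<close>. With \<open>m = L ^ d\<close>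
    the dimension is at most \<open>m * Suc m ^ d\<close>, just below the number
    \<open>Suc m ^ Suc d\<close> of monomials.\<close>
  define L where "L = 2 * Suc d * N + 1"
  define m where "m = L ^ d"
  define M where "M = Suc d * (m * N)"
  define A where "A = (PiE {..<Suc d} (\<lambda>_. {..m}) :: (nat \<Rightarrow> nat) set)"
  have "finite A" unfolding A_def by (rule finite_PiE) simp_all
  moreover have "A \<subseteq> extensional {..<Suc d}" unfolding A_def PiE_def by (rule Int_lower2)
  moreover have "card A = Suc m ^ Suc d" unfolding A_def by (subst card_PiE) simp_all
  ultimately have A: "finite A" "A \<subseteq> extensional {..<Suc d}" "card A = Suc m ^ Suc d" .
  have sp: "spanned M (\<lambda>x. \<Prod>i<Suc d. f i x ^ \<alpha> i)" if \<alpha>: "\<alpha> \<in> A" for \<alpha>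
  proof -
    have le: "\<alpha> i * N \<le> m * N" if "i < Suc d" for i
      using \<alpha> that by (auto simp: A_def PiE_def Pi_def)
    have "bounded_shift (\<lambda>x. f i x ^ \<alpha> i) (m * N)" if "i < Suc d" for i
      using bounded_shift_power[OF poly[OF that]] le[OF that] by (rule bounded_shift_mono)
    then have "bounded_shift (\<lambda>x. \<Prod>i<Suc d. f i x ^ \<alpha> i) (\<Sum>i<Suc d. m * N)"
      by (intro bounded_shift_prod[where N = "\<lambda>_. m * N"]) simp_all
    then have "bounded_shift (\<lambda>x. \<Prod>i<Suc d. f i x ^ \<alpha> i) M" by (simp only: M_def sum_constant card_lessThan of_nat_id)
    from bounded_shiftD[OF this one] show ?thesis by (simp only: add_0 mult_1_right)
  qed
  then have "\<forall>\<alpha>\<in>A. \<exists>c. \<forall>x\<in>V. (\<Prod>i<Suc d. f i x ^ \<alpha> i) = (\<Sum>j\<in>J M. c j * b j x)"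
    unfolding spanned_def by blast
  then obtain c where c: "\<And>\<alpha> x. \<alpha> \<in> A \<Longrightarrow> x \<in> V \<Longrightarrow>
      (\<Prod>i<Suc d. f i x ^ \<alpha> i) = (\<Sum>j\<in>J M. c \<alpha> j * b j x)"
    by metis
  have le: "2 * M + 1 \<le> L * Suc m" by (simp add: M_def L_def algebra_simps)
  have "card (J M) \<le> (2 * M + 1) ^ d" by (rule card)
  also have "\<dots> \<le> (L * Suc m) ^ d" by (rule power_mono[OF le]) simp
  also have "\<dots> = m * Suc m ^ d" by (simp only: m_def power_mult_distrib)
  also have "\<dots> < Suc m ^ Suc d" by simp
  finally have "card (J M) < card A" using A by simp
  \<comment> \<open>More monomials than generators: some nontrivial combination has all its
    coefficients with respect to the generators equal to 0.\<close>
  from homogeneous_system_nontrivial[OF finite_J A(1) this, of c]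
  obtain l where l: "\<exists>\<alpha>\<in>A. l \<alpha> \<noteq> 0" "\<forall>j\<in>J M. (\<Sum>\<alpha>\<in>A. l \<alpha> * c \<alpha> j) = 0" by blast
  have "(\<Sum>\<alpha>\<in>A. l \<alpha> * (\<Prod>i<Suc d. f i x ^ \<alpha> i)) = 0" if "x \<in> V" for x
  proof -
    have "(\<Sum>\<alpha>\<in>A. l \<alpha> * (\<Prod>i<Suc d. f i x ^ \<alpha> i)) = (\<Sum>\<alpha>\<in>A. \<Sum>j\<in>J M. l \<alpha> * c \<alpha> j * b j x)"
      using c that by (intro sum.cong) (auto simp: sum_distrib_left mult.assoc)
    also have "\<dots> = (\<Sum>j\<in>J M. (\<Sum>\<alpha>\<in>A. l \<alpha> * c \<alpha> j) * b j x)"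
      by (subst sum.swap) (simp add: sum_distrib_right)
    also have "\<dots> = 0" using l by simp
    finally show ?thesis .
  qed
  then have "\<forall>\<alpha>\<in>A. l \<alpha> = 0"
    using ind A unfolding alg_indep_on_def by blast
  then show False using l by blast
qed

lemma krull_dim_le_if_growth:
  assumes coord: "\<And>e. e \<in> Basis \<Longrightarrow> \<exists>N. bounded_shift (\<lambda>x. x \<bullet> e) N"
    and one: "spanned 0 (\<lambda>_. 1)"
    and card: "\<And>M. card (J M) \<le> (2 * M + 1) ^ d"
  shows "krull_dim (subtopology zariski V) \<le> enat d"
proof (rule krull_dim_le_if_alg_dep)
  fix f :: "nat \<Rightarrow> 'a \<Rightarrow> real"
  assume "\<And>i. i < Suc d \<Longrightarrow> real_polynomial_function (f i)"
  then have "\<forall>i. \<exists>N. i < Suc d \<longrightarrow> bounded_shift (f i) N"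
    using bounded_shift_polynomial[OF coord] by blast
  then obtain N where N: "\<And>i. i < Suc d \<Longrightarrow> bounded_shift (f i) (N i)" by metis
  have "bounded_shift (f i) (Max (N ` {..<Suc d}))" if "i < Suc d" for i
    by (rule bounded_shift_mono[OF N[OF that]]) (use that in auto)
  then show "\<not> alg_indep_on V (Suc d) f" by (rule alg_dep_if_growth[OF _ one card])
qed

end

section \<open>The dimension of \<open>W\<close>\<close>

text \<open>\<open>dev23 a\<close>, \<open>dev34 a\<close> and \<open>dev24\<close> are u, v and w
  of the introduction. At the coordinates of a distribution in the model they are covariances of the
  indicators of \<open>X_v = 1\<close>, the first two conditional on \<open>X_1 = a\<close>.\<close>

definition dev23 :: "2 \<Rightarrow> real ^ coord \<Rightarrow> real" where
  "dev23 a q = q $ Q23 a - q $ Q3 a * q $ Q2"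

definition dev34 :: "2 \<Rightarrow> real ^ coord \<Rightarrow> real" where
  "dev34 a q = q $ Q34 a - q $ Q3 a * q $ Q4"

definition dev24 :: "real ^ coord \<Rightarrow> real" where
  "dev24 q = q $ Q24 - q $ Q2 * q $ Q4"

lemmas dev_defs = dev23_def dev34_def dev24_def

text \<open>The second equation of \<open>W\<close> is linear in \<open>Q234 a\<close> with
  coefficient 1. Solving it and substituting into the first leaves the product relation.\<close>

lemma W_iff_dev:
  "q \<in> W \<longleftrightarrow> (\<forall>a. dev23 a q * dev34 a q = q $ Q3 a * (1 - q $ Q3 a) * dev24 q \<and>
     q $ Q234 a = q $ Q3 a * q $ Q2 * q $ Q4 + q $ Q2 * dev34 a q + q $ Q4 * dev23 a q
       + (1 - q $ Q3 a) * dev24 q)"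
proof -
  have "(e * f = d * g \<and> d * c - e * b - f * a + g = c - a * b) \<longleftrightarrow>
    ((e - d * a) * (f - d * b) = d * (1 - d) * (c - a * b) \<and>
     g = d * a * b + a * (f - d * b) + b * (e - d * a) + (1 - d) * (c - a * b))"
    for a b c d e f g :: real
    by algebra
  then show ?thesis unfolding W_def dev_defs mem_Collect_eq by presburger
qed

text \<open>A monomial in \<open>x\<close> and \<open>y\<close> not divisible by
  \<open>x * y\<close>, encoded by one integer: positive for a power of \<open>x\<close>, negative
  for a power of \<open>y\<close>.\<close>

definition spower :: "real \<Rightarrow> real \<Rightarrow> int \<Rightarrow> real" where
  "spower x y i = x ^ nat i * y ^ nat (- i)"

text \<open>For negative \<open>i\<close> the new factor \<open>x\<close> meets a factor
  \<open>y\<close>, and the pair is released as \<open>x * y\<close>.\<close>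

lemma spower_mult_left:
  "x * spower x y i = (if i \<ge> 0 then spower x y (i + 1) else x * y * spower x y (i + 1))"
proof (cases "i \<ge> 0")
  case True
  then have "nat (i + 1) = Suc (nat i)" "nat (- (i + 1)) = 0" "nat (- i) = 0" by auto
  with True show ?thesis by (simp add: spower_def)
next
  case False
  then have "nat (- i) = Suc (nat (- (i + 1)))" "nat i = 0" "nat (i + 1) = 0" by auto
  with False show ?thesis by (simp add: spower_def)
qed

lemma spower_minus: "spower x y (- i) = spower y x i"
  by (simp add: spower_def mult.commute)

lemma spower_mult_right:
  "y * spower x y i = (if i \<le> 0 then spower x y (i - 1) else x * y * spower x y (i - 1))"
  using spower_mult_left[of y x "- i"] spower_minus[of y x i] spower_minus[of y x "i - 1"]
  by (simp add: mult.commute)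

section \<open>Normal-form monomials on \<open>W\<close> and their number\<close>

type_synonym exponents = "nat \<times> nat \<times> nat \<times> (2 \<Rightarrow> nat) \<times> (2 \<Rightarrow> int)"

definition exponent_box :: "nat \<Rightarrow> exponents set" where
  "exponent_box M = {..M} \<times> {..M} \<times> {..M} \<times> (UNIV \<rightarrow>\<^sub>E {..M}) \<times> (UNIV \<rightarrow>\<^sub>E {- int M..int M})"

text \<open>On \<open>W\<close> the products \<open>dev23 a q * dev34 a q\<close> can be eliminated, so that powers of only one
  of the two factors are needed.\<close>

fun monomial :: "exponents \<Rightarrow> real ^ coord \<Rightarrow> real" where
  "monomial (e2, e4, e, k, i) q = q $ Q2 ^ e2 * q $ Q4 ^ e4 * dev24 q ^ e *
     (\<Prod>a\<in>UNIV. q $ Q3 a ^ k a * spower (dev23 a q) (dev34 a q) (i a))"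

lemma mem_exponent_box_iff:
  "(e2, e4, e, k, i) \<in> exponent_box M \<longleftrightarrow>
     e2 \<le> M \<and> e4 \<le> M \<and> e \<le> M \<and> (\<forall>a. k a \<le> M) \<and> (\<forall>a. - int M \<le> i a \<and> i a \<le> int M)"
  by (auto simp: exponent_box_def)

text \<open>The source of the dimension 7: five natural exponents with \<open>M + 1\<close> values
  each and two signed ones with \<open>2 * M + 1\<close> values each.\<close>

lemma card_exponent_box: "card (exponent_box M) \<le> (2 * M + 1) ^ 7"
proof -
  define m n where "m = 2 * M + 1" and "n = Suc M"
  have c: "card {- int M..int M} = m" "card {..M} = n" by (simp_all add: m_def n_def)
  have "card (exponent_box M) = n * (n * (n * (n ^ 2 * m ^ 2)))"
    by (simp add: exponent_box_def card_cartesian_product card_PiE c del: card_atLeastAtMost_int card_atMost)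
  also have "\<dots> = n ^ 5 * m ^ 2" by algebra
  also have "\<dots> \<le> m ^ 5 * m ^ 2"
    by (intro mult_right_mono power_mono) (auto simp: m_def n_def)
  finally show ?thesis by (simp add: m_def flip: power_add)
qed

interpretation W: filtered_functions W exponent_box monomial
proof
  show "finite (exponent_box M)" for M unfolding exponent_box_def by (intro finite_cartesian_product finite_PiE) auto
  show "exponent_box M \<subseteq> exponent_box N" if "M \<le> N" for M N
    unfolding exponent_box_def by (intro Sigma_mono PiE_mono) (use that in auto)
qed

lemma bounded_shift_monomials:
  assumes "\<And>M j. j \<in> exponent_box M \<Longrightarrow> s j \<in> exponent_box (M + 2)"
    and "\<And>j q. q \<in> W \<Longrightarrow> f q * monomial j q = monomial (s j) q"
  shows "W.bounded_shift f 2"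
proof (rule W.bounded_shift_if_base)
  fix M j assume j: "j \<in> exponent_box M"
  show "W.spanned (M + 2) (\<lambda>q. f q * monomial j q)"
    by (rule W.spanned_cong[OF W.spanned_base[OF assms(1)[OF j]]]) (simp add: assms(2))
qed

text \<open>\<open>P j\<close> says that nothing has to be eliminated. Otherwise the released
  product expands into two monomials, since \<open>q3 * (1 - q3) * w = q3 * w - q3^2 * w\<close>;
  the square accounts for the shift 2.\<close>

lemma bounded_shift_monomials_diff:
  assumes "\<And>M j. j \<in> exponent_box M \<Longrightarrow> s j \<in> exponent_box (M + 2)" "\<And>M j. j \<in> exponent_box M \<Longrightarrow> t j \<in> exponent_box (M + 2)"
    and "\<And>j q. q \<in> W \<Longrightarrow> f q * monomial j q =
      (if P j then monomial (s j) q else monomial (s j) q + -1 * monomial (t j) q)"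
  shows "W.bounded_shift f 2"
proof (rule W.bounded_shift_if_base)
  fix M j assume j: "j \<in> exponent_box M"
  show "W.spanned (M + 2) (\<lambda>q. f q * monomial j q)"
  proof (cases "P j")
    case True
    show ?thesis
      by (rule W.spanned_cong[OF W.spanned_base[OF assms(1)[OF j]]]) (simp add: assms(3) True)
  next
    case False
    show ?thesis
      by (rule W.spanned_cong[OF W.spanned_add[OF W.spanned_base[OF assms(1)[OF j]]
        W.spanned_scale[OF W.spanned_base[OF assms(2)[OF j]], of "-1"]]]) (simp add: assms(3) False)
  qed
qed

lemma dev_mult:
  assumes "q \<in> W"
  shows "dev23 a q * dev34 a q = q $ Q3 a * (1 - q $ Q3 a) * dev24 q"
  using assms unfolding W_iff_dev by blast

lemma monomial_fun_upd:
  "monomial (e2, e4, e, k(a := m), i(a := l)) q = q $ Q2 ^ e2 * q $ Q4 ^ e4 * dev24 q ^ e *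
     (q $ Q3 a ^ m * spower (dev23 a q) (dev34 a q) l *
      (\<Prod>b\<in>UNIV - {a}. q $ Q3 b ^ k b * spower (dev23 b q) (dev34 b q) (i b)))"
  by (simp add: prod.remove[of UNIV a])

text \<open>Treats \<open>dev23 a\<close> (\<open>s = 1\<close>) and \<open>dev34 a\<close>
  (\<open>s = -1\<close>) together; \<open>s\<close> is the change of the signed exponent.\<close>

lemma bounded_shift_dev:
  assumes f: "\<And>q i. q \<in> W \<Longrightarrow> f q * spower (dev23 a q) (dev34 a q) i =
      (if P i then 1 else dev23 a q * dev34 a q) * spower (dev23 a q) (dev34 a q) (i + s)"
    and s: "s = 1 \<or> s = -1"
  shows "W.bounded_shift f 2"
proof (rule bounded_shift_monomials_diff)
  let ?s = "\<lambda>(e2, e4, e, k, i). if P (i a) then (e2, e4, e, k, i(a := i a + s))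
      else (e2, e4, e + 1, k(a := k a + 1), i(a := i a + s)) :: exponents"
  let ?t = "\<lambda>(e2, e4, e, k, i). (e2, e4, e + 1, k(a := k a + 2), i(a := i a + s)) :: exponents"
  let ?P = "\<lambda>(e2 :: nat, e4 :: nat, e :: nat, k :: 2 \<Rightarrow> nat, i). P (i a)"
  show "?s j \<in> exponent_box (M + 2)" if "j \<in> exponent_box M" for M j
    using that s exhaust_2[of a] by (cases j) (auto simp: mem_exponent_box_iff forall_2)
  show "?t j \<in> exponent_box (M + 2)" if "j \<in> exponent_box M" for M j
    using that s exhaust_2[of a] by (cases j) (auto simp: mem_exponent_box_iff forall_2)
  show "f q * monomial j q = (if ?P j then monomial (?s j) q else monomial (?s j) q + -1 * monomial (?t j) q)"
    if q: "q \<in> W" for j q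
  proof (cases j)
    case (fields e2 e4 e k i)
    define R where "R = (\<Prod>b\<in>UNIV - {a}. q $ Q3 b ^ k b * spower (dev23 b q) (dev34 b q) (i b))"
    note upd = monomial_fun_upd[of _ _ _ k a _ i _ q, folded R_def]
    have "f q * monomial j q =
        q $ Q2 ^ e2 * q $ Q4 ^ e4 * dev24 q ^ e * q $ Q3 a ^ k a * R * (f q * spower (dev23 a q) (dev34 a q) (i a))"
      unfolding fields using upd[of e2 e4 e "k a" "i a"] unfolding fun_upd_triv by (simp del: monomial.simps)
    also have "\<dots> = (if ?P j then monomial (?s j) q else monomial (?s j) q + -1 * monomial (?t j) q)"
    proof (cases "P (i a)")
      case True
      then show ?thesis
        using upd[of e2 e4 e "k a" "i a + s"] unfolding f[OF q] fun_upd_triv by (simp add: fields del: monomial.simps)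
    next
      case False
      then show ?thesis
        unfolding f[OF q] dev_mult[OF q]
        by (simp add: fields upd del: monomial.simps) (simp add: algebra_simps power2_eq_square)
    qed
    finally show ?thesis .
  qed
qed

lemma bounded_shift_Q2: "W.bounded_shift (\<lambda>q. q $ Q2) 2"
  by (rule bounded_shift_monomials[where s = "\<lambda>(e2, r). (e2 + 1, r)"])
    (auto simp: mem_exponent_box_iff forall_2)

lemma bounded_shift_Q4: "W.bounded_shift (\<lambda>q. q $ Q4) 2"
  by (rule bounded_shift_monomials[where s = "\<lambda>(e2, e4, r). (e2, e4 + 1, r)"])
    (auto simp: mem_exponent_box_iff forall_2)

lemma bounded_shift_dev24: "W.bounded_shift dev24 2"
  by (rule bounded_shift_monomials[where s = "\<lambda>(e2, e4, e, r). (e2, e4, e + 1, r)"])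
    (auto simp: mem_exponent_box_iff forall_2)

lemma bounded_shift_Q3: "W.bounded_shift (\<lambda>q. q $ Q3 a) 2"
proof (rule bounded_shift_monomials)
  let ?s = "\<lambda>(e2, e4, e, k, i). (e2, e4, e, k(a := k a + 1), i) :: exponents"
  show "?s j \<in> exponent_box (M + 2)" if "j \<in> exponent_box M" for M j
    using that exhaust_2[of a] by (cases j) (auto simp: mem_exponent_box_iff forall_2)
  show "q $ Q3 a * monomial j q = monomial (?s j) q" for j q
  proof (cases j)
    case (fields e2 e4 e k i)
    show ?thesis
      unfolding fields using monomial_fun_upd[of e2 e4 e k a "k a" i "i a" q]
        monomial_fun_upd[of e2 e4 e k a "k a + 1" i "i a" q]
      unfolding fun_upd_triv by (simp del: monomial.simps)
  qed
qed

text \<open>On \<open>W\<close> every coordinate is a polynomial in \<open>Q2\<close>,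
  \<open>Q4\<close>, \<open>Q3 a\<close> and the deviations.\<close>

lemma bounded_shift_coordinate: "\<exists>N. W.bounded_shift (\<lambda>q. q $ k) N"
proof -
  note add = W.bounded_shift_add and mult = W.bounded_shift_mult
  have dev23: "W.bounded_shift (dev23 a) 2" for a
    by (rule bounded_shift_dev[of _ a "\<lambda>i. i \<ge> 0" 1]) (simp_all add: spower_mult_left)
  have dev34: "W.bounded_shift (dev34 a) 2" for a
    by (rule bounded_shift_dev[of _ a "\<lambda>i. i \<le> 0" "-1"]) (simp_all add: spower_mult_right)
  note Q2 = bounded_shift_Q2 and Q4 = bounded_shift_Q4 and Q3 = bounded_shift_Q3
  show ?thesis
  proof (cases k)
    case Q24
    have "W.bounded_shift (\<lambda>q. q $ Q24) (max 2 (2 + 2))"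
      by (rule W.bounded_shift_cong[OF add[OF bounded_shift_dev24 mult[OF Q2 Q4]]])
        (simp add: dev24_def)
    then show ?thesis unfolding Q24 by (rule exI)
  next
    case (Q23 a)
    have "W.bounded_shift (\<lambda>q. q $ Q23 a) (max 2 (2 + 2))"
      by (rule W.bounded_shift_cong[OF add[OF dev23[of a] mult[OF Q3[of a] Q2]]]) (simp add: dev23_def)
    then show ?thesis unfolding Q23 by (rule exI)
  next
    case (Q34 a)
    have "W.bounded_shift (\<lambda>q. q $ Q34 a) (max 2 (2 + 2))"
      by (rule W.bounded_shift_cong[OF add[OF dev34[of a] mult[OF Q3[of a] Q4]]]) (simp add: dev34_def)
    then show ?thesis unfolding Q34 by (rule exI)
  next
    case (Q234 a)
    note shift = add[OF add[OF mult[OF mult[OF Q3[of a] Q2] Q4]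
      add[OF mult[OF Q2 dev34[of a]] mult[OF Q4 dev23[of a]]]]
      mult[OF add[OF W.bounded_shift_const[of 1] mult[OF W.bounded_shift_const[of "-1"] Q3[of a]]]
        bounded_shift_dev24]]
    show ?thesis unfolding Q234
      by (rule exI, rule W.bounded_shift_cong[OF shift]) (use W_iff_dev in auto)
  qed (use Q2 Q4 Q3 in \<open>blast+\<close>)
qed

lemma krull_dim_W_le: "krull_dim (subtopology zariski W) \<le> enat 7"
proof (rule W.krull_dim_le_if_growth)
  fix e :: "real ^ coord" assume "e \<in> Basis"
  then obtain k where "e = axis k 1" by (auto simp: Basis_vec_def)
  then have "(\<lambda>q. q \<bullet> e) = (\<lambda>q. q $ k)" by (simp add: inner_axis)
  then show "\<exists>N. W.bounded_shift (\<lambda>q. q \<bullet> e) N" using bounded_shift_coordinate by simp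
next
  have "W.spanned 0 (monomial (0, 0, 0, \<lambda>_. 0, \<lambda>_. 0))"
    by (rule W.spanned_base) (auto simp: exponent_box_def)
  then show "W.spanned 0 (\<lambda>_. 1)" by (rule W.spanned_cong) (simp add: spower_def)
qed (rule card_exponent_box)

section \<open>Polynomial charts and tangent spaces\<close>

lemma finite_zeros_real_polynomial_function:
  fixes f :: "real \<Rightarrow> real"
  assumes f: "real_polynomial_function f" and t0: "f t0 \<noteq> 0"
  shows "finite {t. f t = 0}"
proof -
  obtain a n where f: "f = (\<lambda>x. \<Sum>i\<le>n. a i * x ^ i)"
    using f unfolding real_polynomial_function_iff_sum by blast
  have "\<exists>i\<le>n. a i \<noteq> 0"
  proof (rule ccontr)
    assume "\<not> (\<exists>i\<le>n. a i \<noteq> 0)"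
    then have "f t0 = 0" by (simp add: f)
    with t0 show False by simp
  qed
  then show ?thesis unfolding f polyfun_finite_roots .
qed

lemma polynomial_function_line: "polynomial_function (\<lambda>t :: real. p + t *\<^sub>R v)"
  by (intro polynomial_function_add polynomial_function_const polynomial_function_mult
    polynomial_function_id)

text \<open>Each member of \<open>F\<close> restricts to a nonzero polynomial in \<open>t\<close>,
  so only finitely many parameters are excluded. The value 0 is excluded too, in order to move away
  from \<open>p\<close>.\<close>

lemma polynomial_functions_nonzero_on_line:
  fixes p v :: "'a::real_normed_vector"
  assumes fin: "finite F" and f: "\<And>f. f \<in> F \<Longrightarrow> real_polynomial_function f \<and> (\<exists>t. f (p + t *\<^sub>R v) \<noteq> 0)"
  obtains t where "t \<noteq> 0" "\<And>f. f \<in> F \<Longrightarrow> f (p + t *\<^sub>R v) \<noteq> 0"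
proof -
  have "finite {t. f (p + t *\<^sub>R v) = 0}" if fF: "f \<in> F" for f
  proof -
    have "real_polynomial_function (f \<circ> (\<lambda>t. p + t *\<^sub>R v))"
      using f[OF fF] polynomial_function_line by (intro real_polynomial_function_compose) auto
    moreover obtain t0 where "(f \<circ> (\<lambda>t. p + t *\<^sub>R v)) t0 \<noteq> 0" using f[OF fF] by auto
    ultimately show ?thesis using finite_zeros_real_polynomial_function by fastforce
  qed
  then have "finite (insert 0 (\<Union>f\<in>F. {t. f (p + t *\<^sub>R v) = 0}))" using fin by simp
  then obtain t where "t \<notin> insert 0 (\<Union>f\<in>F. {t. f (p + t *\<^sub>R v) = 0})"
    using ex_new_if_finite infinite_UNIV_char_0 by blast
  then show ?thesis using that[of t] by auto
qed

text \<open>The nonvanishing sets of single polynomials form a base: one defining equation of the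
  complement that fails at \<open>x\<close> is enough.\<close>

lemma openin_subtopology_zariskiE:
  assumes "openin (subtopology zariski V) U" "x \<in> U"
  obtains h where "real_polynomial_function h" "h x \<noteq> 0" "{y \<in> V. h y \<noteq> 0} \<subseteq> U"
proof -
  from assms(1) obtain T where T: "openin zariski T" "U = T \<inter> V" unfolding openin_subtopology by blast
  then obtain H where H: "\<forall>f\<in>H. real_polynomial_function f" "- T = {x. \<forall>f\<in>H. f x = 0}"
    unfolding openin_zariski algebraic_set_def by blast
  have "x \<notin> - T" using assms T by simp
  then obtain h where h: "h \<in> H" "h x \<noteq> 0" unfolding H(2) by blast
  have "y \<in> T" if "h y \<noteq> 0" for y
  proof -
    have "y \<notin> - T" unfolding H(2) using h that by blast
    then show ?thesis by simp
  qed
  then show ?thesis using that[of h] H h T by blast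
qed

text \<open>For \<open>S \<subseteq> V\<close> this is the Zariski closure of \<open>S\<close>
  relative to \<open>V\<close>; below, \<open>V\<close> is instantiated with a neighbourhood
  \<open>U\<close> that need not be closed.\<close>

definition zariski_hull :: "'a::euclidean_space set \<Rightarrow> 'a set \<Rightarrow> 'a set" where
  "zariski_hull V S = {x \<in> V. \<forall>f\<in>vanishing_ideal S. f x = 0}"

lemma closedin_zariski_hull: "closedin (subtopology zariski V) (zariski_hull V S)"
proof -
  have "algebraic_set {x. \<forall>f\<in>vanishing_ideal S. f x = 0}"
    unfolding algebraic_set_def
    by (intro exI[of _ "vanishing_ideal S"] conjI refl) (simp add: vanishing_ideal_def)
  moreover have "zariski_hull V S = {x. \<forall>f\<in>vanishing_ideal S. f x = 0} \<inter> V"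
    by (auto simp: zariski_hull_def)
  ultimately show ?thesis unfolding closedin_subtopology closedin_zariski by blast
qed

lemma zariski_hull_mono: "S \<subseteq> T \<Longrightarrow> zariski_hull V S \<subseteq> zariski_hull V T"
  unfolding zariski_hull_def vanishing_ideal_def by blast

lemma subset_zariski_hull: "S \<subseteq> V \<Longrightarrow> S \<subseteq> zariski_hull V S"
  unfolding zariski_hull_def vanishing_ideal_def by auto

text \<open>A polynomial map sends the line joining two points of \<open>S\<close> to a curve on which a nonzero
  polynomial function has only finitely many zeros.\<close>

lemma irreducible_zariski_hull_image:
  fixes \<psi> :: "'b::euclidean_space \<Rightarrow> 'a::euclidean_space"
  assumes aff: "affine S" and \<psi>: "polynomial_function \<psi>" and range: "range \<psi> \<subseteq> V"
    and U: "openin (subtopology zariski V) U" and ne: "\<psi> ` S \<inter> U \<noteq> {}"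
  shows "irreducible_space (subtopology zariski (zariski_hull U (\<psi> ` S \<inter> U)))"
    (is "irreducible_space (subtopology zariski ?Z)")
  unfolding irreducible_space_def
proof (intro conjI allI impI)
  have sub: "\<psi> ` S \<inter> U \<subseteq> ?Z" by (rule subset_zariski_hull) simp
  then show "topspace (subtopology zariski ?Z) \<noteq> {}" using ne by auto
  fix A B
  assume AB: "closedin (subtopology zariski ?Z) A \<and> closedin (subtopology zariski ?Z) B \<and>
    A \<union> B = topspace (subtopology zariski ?Z)"
  \<comment> \<open>A polynomial vanishing on the image vanishes on its whole hull, so an equation
    of a proper closed subset already fails at a point of the image.\<close>
  have ex: "\<exists>f s. real_polynomial_function f \<and> (\<forall>x\<in>A. f x = 0) \<and> s \<in> S \<and> \<psi> s \<in> U \<and> f (\<psi> s) \<noteq> 0"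
    if A: "closedin (subtopology zariski ?Z) A" "A \<noteq> ?Z" for A
  proof -
    obtain F where F: "\<forall>f\<in>F. real_polynomial_function f" "A = {x. \<forall>f\<in>F. f x = 0} \<inter> ?Z"
      using A(1) unfolding closedin_subtopology closedin_zariski algebraic_set_def by auto
    with A(2) obtain x f where x: "x \<in> ?Z" "f \<in> F" "f x \<noteq> 0" by blast
    have "\<not> (\<forall>y\<in>\<psi> ` S \<inter> U. f y = 0)"
      using x F(1) by (auto simp: zariski_hull_def vanishing_ideal_def)
    then show ?thesis using x F by blast
  qed
  show "A = topspace (subtopology zariski ?Z) \<or> B = topspace (subtopology zariski ?Z)"
  proof (rule ccontr)
    assume "\<not> ?thesis"
    then have "A \<noteq> ?Z" "B \<noteq> ?Z" by auto
    with AB ex[of A] ex[of B] obtain f s g r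
      where f: "real_polynomial_function f" "\<forall>x\<in>A. f x = 0" "s \<in> S" "\<psi> s \<in> U" "f (\<psi> s) \<noteq> 0"
        and g: "real_polynomial_function g" "\<forall>x\<in>B. g x = 0" "r \<in> S" "\<psi> r \<in> U" "g (\<psi> r) \<noteq> 0"
      by auto
    \<comment> \<open>\<open>h\<close> keeps the curve in \<open>U\<close>: where \<open>f\<close>,
      \<open>g\<close> and \<open>h\<close> are all nonzero, the point lies in the hull but in
      neither \<open>A\<close> nor \<open>B\<close>.\<close>
    obtain h where h: "real_polynomial_function h" "h (\<psi> s) \<noteq> 0" "{y \<in> V. h y \<noteq> 0} \<subseteq> U"
      using openin_subtopology_zariskiE[OF U f(4)] by blast
    obtain t where t: "\<And>k. k \<in> {f \<circ> \<psi>, g \<circ> \<psi>, h \<circ> \<psi>} \<Longrightarrow> k (s + t *\<^sub>R (r - s)) \<noteq> 0"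
    proof (rule polynomial_functions_nonzero_on_line[of "{f \<circ> \<psi>, g \<circ> \<psi>, h \<circ> \<psi>}" s "r - s"])
      have z: "s + 0 *\<^sub>R (r - s) = s" "s + 1 *\<^sub>R (r - s) = r" by simp_all
      show "real_polynomial_function k \<and> (\<exists>t. k (s + t *\<^sub>R (r - s)) \<noteq> 0)"
        if k: "k \<in> {f \<circ> \<psi>, g \<circ> \<psi>, h \<circ> \<psi>}" for k
      proof
        show "real_polynomial_function k"
          using k f(1) g(1) h(1) \<psi> by (auto simp del: o_apply)
        have "k (s + 0 *\<^sub>R (r - s)) \<noteq> 0 \<or> k (s + 1 *\<^sub>R (r - s)) \<noteq> 0"
          unfolding z using k f(5) g(5) h(2) by auto
        then show "\<exists>t. k (s + t *\<^sub>R (r - s)) \<noteq> 0" by blast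
      qed
    qed auto
    define y where "y = s + t *\<^sub>R (r - s)"
    have "y = (1 - t) *\<^sub>R s + t *\<^sub>R r" by (simp add: y_def algebra_simps)
    then have "y \<in> S" using aff f(3) g(3) by (simp add: mem_affine)
    moreover have fgh: "f (\<psi> y) \<noteq> 0" "g (\<psi> y) \<noteq> 0" "h (\<psi> y) \<noteq> 0"
      using t[of "f \<circ> \<psi>"] t[of "g \<circ> \<psi>"] t[of "h \<circ> \<psi>"] unfolding y_def by auto
    moreover have "\<psi> y \<in> U" using h(3) fgh(3) range by auto
    ultimately have "\<psi> y \<in> ?Z" using sub by blast
    then have "\<psi> y \<in> A \<or> \<psi> y \<in> B" using AB by auto
    then show False using f(2) g(2) fgh by auto
  qed
qed

text \<open>Freeing the parameters in \<open>K\<close> one at a time gives, inside any neighbourhood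
  of \<open>\<psi> p\<close>, a chain of closures of images of affine subspaces. The function
  \<open>F j\<close> proves the step that frees \<open>j\<close> strict: it vanishes while
  \<open>t $ j\<close> is frozen at \<open>p $ j\<close>, and not generically afterwards because
  \<open>m j p \<noteq> 0\<close>.\<close>

lemma local_dim_ge_if_chart:
  fixes \<psi> :: "real ^ 'n \<Rightarrow> 'a::euclidean_space"
  assumes \<psi>: "polynomial_function \<psi>" and range: "range \<psi> \<subseteq> V"
    and F: "\<And>j. j \<in> K \<Longrightarrow> real_polynomial_function (F j)"
    and m: "\<And>j. j \<in> K \<Longrightarrow> real_polynomial_function (m j)" "\<And>j. j \<in> K \<Longrightarrow> m j p \<noteq> 0"
    and Fm: "\<And>j t. j \<in> K \<Longrightarrow> F j (\<psi> t) = m j t * (t $ j - p $ j)"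
  shows "enat (card K) \<le> local_dim (subtopology zariski V) (\<psi> p)"
  unfolding local_dim_def
proof (rule Inf_greatest, clarify)
  fix U
  assume U: "openin (subtopology zariski V) U" and pU: "\<psi> p \<in> U"
  obtain h where h: "real_polynomial_function h" "h (\<psi> p) \<noteq> 0" "{y \<in> V. h y \<noteq> 0} \<subseteq> U"
    using openin_subtopology_zariskiE[OF U pU] by blast
  have "U \<subseteq> V" using openin_subset[OF U] by simp
  then have UV: "subtopology (subtopology zariski V) U = subtopology zariski U"
    by (simp add: subtopology_subtopology Int_absorb1)
  obtain e where e: "bij_betw e {..<card K} K"
    using ex_bij_betw_nat_finite[of K] by (auto simp: atLeast0LessThan)
  \<comment> \<open>The parameters \<open>e l\<close> with \<open>l \<ge> k\<close> are frozen;
    those outside \<open>K\<close> are free in every \<open>S k\<close>.\<close>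
  define S where "S k = {t. \<forall>l\<in>{k..<card K}. t $ e l = p $ e l}" for k
  define Z where "Z k = zariski_hull U (\<psi> ` S k \<inter> U)" for k
  have "affine (S k)" for k
    unfolding affine_def S_def by (auto simp flip: distrib_right)
  moreover have pS: "p \<in> S k" for k by (simp add: S_def)
  ultimately have irr: "irreducible_space (subtopology zariski (Z k))" for k
    unfolding Z_def using pU by (intro irreducible_zariski_hull_image[OF _ \<psi> range U]) blast+
  have cl: "closedin (subtopology zariski U) (Z k)" for k
    unfolding Z_def by (rule closedin_zariski_hull)
  have ZU: "Z k \<subseteq> U" for k by (auto simp: Z_def zariski_hull_def)
  have strict: "Z k \<subset> Z (Suc k)" if k: "k < card K" for k
  proof
    show "Z k \<subseteq> Z (Suc k)"
      unfolding Z_def by (intro zariski_hull_mono Int_mono image_mono) (auto simp: S_def)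
    let ?j = "e k"
    have j: "?j \<in> K" using e k by (auto simp: bij_betw_def)
    have F0: "F ?j x = 0" if "x \<in> Z k" for x
    proof -
      have "F ?j \<in> vanishing_ideal (\<psi> ` S k \<inter> U)"
        using F[OF j] Fm[OF j] k by (auto simp: vanishing_ideal_def S_def)
      with that show ?thesis by (auto simp: Z_def zariski_hull_def)
    qed
    obtain t where t: "t \<noteq> 0" "\<And>f. f \<in> {m ?j, h \<circ> \<psi>} \<Longrightarrow> f (p + t *\<^sub>R axis ?j 1) \<noteq> 0"
    proof (rule polynomial_functions_nonzero_on_line[of "{m ?j, h \<circ> \<psi>}" p "axis ?j 1"])
      show "real_polynomial_function f \<and> (\<exists>t. f (p + t *\<^sub>R axis ?j 1) \<noteq> 0)"
        if f: "f \<in> {m ?j, h \<circ> \<psi>}" for f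
      proof
        show "real_polynomial_function f" using f m(1)[OF j] h(1) \<psi> by (auto simp del: o_apply)
        have "f (p + 0 *\<^sub>R axis ?j 1) \<noteq> 0" using f m(2)[OF j] h(2) by auto
        then show "\<exists>t. f (p + t *\<^sub>R axis ?j 1) \<noteq> 0" by blast
      qed
    qed auto
    define y where "y = p + t *\<^sub>R axis ?j 1"
    have "y \<in> S (Suc k)"
      unfolding S_def
    proof (intro CollectI ballI)
      fix l assume l: "l \<in> {Suc k..<card K}"
      then have "e l \<noteq> ?j" using inj_on_eq_iff[OF bij_betw_imp_inj_on[OF e], of l k] k by auto
      then show "y $ e l = p $ e l" by (simp add: y_def axis_def)
    qed
    moreover have "\<psi> y \<in> U" using t(2)[of "h \<circ> \<psi>"] h(3) range by (auto simp: y_def)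
    ultimately have "\<psi> y \<in> Z (Suc k)"
      unfolding Z_def using subset_zariski_hull[of "\<psi> ` S (Suc k) \<inter> U" U] by blast
    moreover have "F ?j (\<psi> y) \<noteq> 0"
      using t unfolding Fm[OF j] by (auto simp: y_def axis_def)
    ultimately show "Z k \<noteq> Z (Suc k)" using F0 by auto
  qed
  show "enat (card K) \<le> krull_dim (subtopology (subtopology zariski V) U)"
    unfolding krull_dim_def UV
  proof (rule Sup_upper, intro CollectI exI conjI allI impI)
    show "enat (card K) = enat (card K)" ..
    show "closedin (subtopology zariski U) (Z k)" for k by (rule cl)
    show "irreducible_space (subtopology (subtopology zariski U) (Z k))" for k
      using irr[of k] by (simp add: subtopology_subtopology Int_absorb1[OF ZU])
    show "Z k \<subset> Z (Suc k)" if "k < card K" for k by (rule strict[OF that])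
  qed
qed

section \<open>Bounds for dimensions of tangent spaces\<close>

lemma subspace_zariski_tangent_space: "subspace (zariski_tangent_space V x)"
proof -
  have "linear (frechet_derivative f (at x))" if "f \<in> vanishing_ideal V" for f
    using that differentiable_at_real_polynomial_function
    by (intro linear_frechet_derivative) (auto simp: vanishing_ideal_def)
  then show ?thesis
    unfolding subspace_def zariski_tangent_space_def
    by (auto simp: linear_0 linear_add linear_scale)
qed

text \<open>Every \<open>f\<close> in the vanishing ideal composes with \<open>\<psi>\<close> to the
  zero function; the chain rule does the rest.\<close>

lemma derivative_in_zariski_tangent_space:
  assumes D: "(\<psi> has_derivative D) (at p)" and range: "range \<psi> \<subseteq> V"
  shows "D v \<in> zariski_tangent_space V (\<psi> p)"
  unfolding zariski_tangent_space_def
proof (intro CollectI ballI)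
  fix f assume f: "f \<in> vanishing_ideal V"
  have "f differentiable at (\<psi> p)"
    using f differentiable_at_real_polynomial_function by (auto simp: vanishing_ideal_def)
  then have "(f has_derivative frechet_derivative f (at (\<psi> p))) (at (\<psi> p))"
    by (simp only: frechet_derivative_works)
  then have "((\<lambda>t. f (\<psi> t)) has_derivative (\<lambda>v. frechet_derivative f (at (\<psi> p)) (D v))) (at p)"
    by (rule has_derivative_compose[OF D])
  moreover have "(\<lambda>t. f (\<psi> t)) = (\<lambda>_. 0)" using f range by (auto simp: vanishing_ideal_def)
  ultimately have "(\<lambda>v. frechet_derivative f (at (\<psi> p)) (D v)) = (\<lambda>_. 0)"
    using has_derivative_const has_derivative_unique by metis
  then show "frechet_derivative f (at (\<psi> p)) (D v) = 0" by metis
qed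

lemma derivative_zero_on_zariski_tangent_space:
  assumes "v \<in> zariski_tangent_space V x" "f \<in> vanishing_ideal V" "(f has_derivative f') (at x)"
  shows "f' v = 0"
  using assms(1,2) frechet_derivative_at[OF assms(3)] by (auto simp: zariski_tangent_space_def)

lemma dim_coordinate_subspace: "dim {x :: real ^ 'n. \<forall>i. i \<notin> K \<longrightarrow> x $ i = 0} = card K"
  using dim_substandard_cart[of K, where 'a = real] by (simp add: dim_vec_eq)

lemma subspace_coordinates: "subspace {x :: real ^ 'n. \<forall>i. i \<notin> K \<longrightarrow> x $ i = 0}"
  by (auto simp: subspace_def)

lemma dim_ge_if_inj_on_coordinates:
  fixes D :: "real ^ 'n \<Rightarrow> 'a::euclidean_space"
  assumes lin: "linear D" and T: "\<And>v. D v \<in> T"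
    and inj: "\<And>v. (\<And>i. i \<notin> K \<Longrightarrow> v $ i = 0) \<Longrightarrow> D v = 0 \<Longrightarrow> v = 0"
  shows "card K \<le> dim T"
proof -
  let ?C = "{x :: real ^ 'n. \<forall>i. i \<notin> K \<longrightarrow> x $ i = 0}"
  have "inj_on D ?C"
    using inj by (subst linear_inj_on_iff_eq_0[OF lin subspace_coordinates]) auto
  then have "dim (D ` ?C) = dim ?C"
    by (intro dim_image_eq lin) (simp add: span_eq_iff[THEN iffD2, OF subspace_coordinates])
  then have "card K = dim (D ` ?C)" by (simp add: dim_coordinate_subspace)
  also have "\<dots> \<le> dim T" using T by (intro dim_subset) auto
  finally show ?thesis .
qed

lemma dim_le_if_determined_by_coordinates:
  fixes T :: "(real ^ 'n) set"
  assumes T: "subspace T" and inj: "\<And>v. v \<in> T \<Longrightarrow> (\<And>k. k \<in> K \<Longrightarrow> v $ k = 0) \<Longrightarrow> v = 0"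
  shows "dim T \<le> card K"
proof -
  let ?\<pi> = "\<lambda>v :: real ^ 'n. \<chi> k. if k \<in> K then v $ k else 0"
  have lin: "linear ?\<pi>" by (rule linearI) (auto simp: vec_eq_iff)
  have "inj_on ?\<pi> T"
    by (subst linear_inj_on_iff_eq_0[OF lin T]) (use inj in \<open>auto simp: vec_eq_iff\<close>)
  then have "dim (?\<pi> ` T) = dim T"
    by (intro dim_image_eq lin) (simp add: span_eq_iff[THEN iffD2, OF T])
  moreover have "dim (?\<pi> ` T) \<le> dim {x :: real ^ 'n. \<forall>i. i \<notin> K \<longrightarrow> x $ i = 0}"
    by (intro dim_subset) auto
  ultimately show ?thesis by (simp add: dim_coordinate_subspace)
qed

text \<open>Differentiating \<open>Fm\<close> at \<open>p\<close>, where the second factor vanishes,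
  recovers \<open>m j p * v $ j\<close> from the image of \<open>v\<close>; hence the derivative of
  \<open>\<psi>\<close> is injective on the directions in \<open>K\<close>.\<close>

lemma dim_zariski_tangent_space_ge_if_chart:
  fixes \<psi> :: "real ^ 'n \<Rightarrow> 'a::euclidean_space"
  assumes \<psi>: "polynomial_function \<psi>" and range: "range \<psi> \<subseteq> V"
    and F: "\<And>j. j \<in> K \<Longrightarrow> real_polynomial_function (F j)"
    and m: "\<And>j. j \<in> K \<Longrightarrow> real_polynomial_function (m j)" "\<And>j. j \<in> K \<Longrightarrow> m j p \<noteq> 0"
    and Fm: "\<And>j t. j \<in> K \<Longrightarrow> F j (\<psi> t) = m j t * (t $ j - p $ j)"
  shows "card K \<le> dim (zariski_tangent_space V (\<psi> p))"
proof -
  obtain D where D: "(\<psi> has_derivative D) (at p)"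
    using differentiable_at_polynomial_function[OF \<psi>] unfolding differentiable_def by blast
  show ?thesis
  proof (rule dim_ge_if_inj_on_coordinates)
    show "linear D" using D by (rule has_derivative_linear)
    show "D v \<in> zariski_tangent_space V (\<psi> p)" for v
      by (rule derivative_in_zariski_tangent_space[OF D range])
    fix v assume v: "\<And>i. i \<notin> K \<Longrightarrow> v $ i = 0" "D v = 0"
    have "v $ j = 0" if j: "j \<in> K" for j
    proof -
      obtain F' where F': "(F j has_derivative F') (at (\<psi> p))"
        using differentiable_at_real_polynomial_function[OF F[OF j]] unfolding differentiable_def by blast
      obtain m' where m': "(m j has_derivative m') (at p)"
        using differentiable_at_real_polynomial_function[OF m(1)[OF j]] unfolding differentiable_def by blast
      have "((\<lambda>t. F j (\<psi> t)) has_derivative (\<lambda>v. F' (D v))) (at p)"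
        by (rule has_derivative_compose[OF D F'])
      moreover have "((\<lambda>t. m j t * (t $ j - p $ j)) has_derivative
          (\<lambda>v. m j p * (v $ j - 0) + m' v * (p $ j - p $ j))) (at p)"
        by (intro has_derivative_mult m' has_derivative_diff has_derivative_const
          bounded_linear_imp_has_derivative bounded_linear_vec_nth)
      ultimately have "(\<lambda>v. F' (D v)) = (\<lambda>v. m j p * (v $ j - 0) + m' v * (p $ j - p $ j))"
        unfolding Fm[OF j] by (rule has_derivative_unique)
      then have "F' (D v) = m j p * v $ j" by (simp add: fun_eq_iff)
      moreover have "F' 0 = 0" using has_derivative_linear[OF F'] by (rule linear_0)
      ultimately show ?thesis using v m(2)[OF j] by simp
    qed
    with v(1) show "v = 0" by (auto simp: vec_eq_iff)
  qed
qed

section \<open>Singular points of \<open>W\<close>\<close>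

lemma real_polynomial_function_vec_nth: "real_polynomial_function (\<lambda>x :: real ^ 'n. x $ k)"
  by (intro real_polynomial_function.intros(1) bounded_linear_vec_nth)

lemmas real_polynomial_function_intros =
  real_polynomial_function.intros(2,3,4) real_polynomial_function_diff
  real_polynomial_function_vec_nth

lemma polynomial_function_vecI:
  fixes \<psi> :: "'a::real_normed_vector \<Rightarrow> real ^ 'n"
  assumes "\<And>k. real_polynomial_function (\<lambda>t. \<psi> t $ k)"
  shows "polynomial_function \<psi>"
  unfolding polynomial_function_iff_Basis_inner
  using assms by (auto simp: Basis_vec_def inner_axis)

lemma real_polynomial_function_dev:
  "real_polynomial_function (dev23 a)" "real_polynomial_function (dev34 a)" "real_polynomial_function dev24"
  unfolding dev_defs[abs_def] by (intro real_polynomial_function_intros)+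

section \<open>Parametrising \<open>W\<close> by deviations\<close>

definition flip :: "2 \<Rightarrow> 2" where
  "flip a = (if a = 1 then 2 else 1)"

lemma all_2_flip: "(\<forall>a :: 2. P a) \<longleftrightarrow> P a \<and> P (flip a)"
  using exhaust_2[of a] by (auto simp: forall_2 flip_def)

lemma W_eqI:
  assumes "x \<in> W" "y \<in> W" "x $ Q2 = y $ Q2" "x $ Q4 = y $ Q4" "dev24 x = dev24 y"
    and "\<And>a. x $ Q3 a = y $ Q3 a" "\<And>a. dev23 a x = dev23 a y" "\<And>a. dev34 a x = dev34 a y"
  shows "x = y"
proof -
  have "x $ k = y $ k" for k
  proof (cases k)
    case Q24
    then show ?thesis using assms(3,4,5) by (simp add: dev24_def)
  next
    case (Q23 a)
    then show ?thesis using assms(3) assms(6,7)[of a] by (simp add: dev23_def)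
  next
    case (Q34 a)
    then show ?thesis using assms(4) assms(6,8)[of a] by (simp add: dev34_def)
  next
    case (Q234 a)
    then show ?thesis using assms unfolding W_iff_dev by simp
  qed (use assms in auto)
  then show ?thesis by (simp add: vec_eq_iff)
qed

text \<open>The point with prescribed deviations \<open>U\<close>, \<open>V\<close>,
  \<open>w\<close>, obtained by inverting the definitions of the deviations; the entry
  \<open>Q234 a\<close> is the one forced by \<open>W_iff_dev\<close>. Parameters are indexed by the
  same type \<open>coord\<close> as points.\<close>

definition W_point ::
    "(2 \<Rightarrow> real ^ coord \<Rightarrow> real) \<Rightarrow> (2 \<Rightarrow> real ^ coord \<Rightarrow> real) \<Rightarrow> (real ^ coord \<Rightarrow> real) \<Rightarrow> real ^ coord \<Rightarrow> real ^ coord"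
  where "W_point U V w t = (\<chi> k. case k of
       Q2 \<Rightarrow> t $ Q2
     | Q4 \<Rightarrow> t $ Q4
     | Q24 \<Rightarrow> t $ Q2 * t $ Q4 + w t
     | Q3 a \<Rightarrow> t $ Q3 a
     | Q23 a \<Rightarrow> t $ Q3 a * t $ Q2 + U a t
     | Q34 a \<Rightarrow> t $ Q3 a * t $ Q4 + V a t
     | Q234 a \<Rightarrow> t $ Q3 a * t $ Q2 * t $ Q4 + t $ Q2 * V a t + t $ Q4 * U a t + (1 - t $ Q3 a) * w t)"

lemma W_point_simps:
  "W_point U V w t $ Q2 = t $ Q2" "W_point U V w t $ Q4 = t $ Q4" "W_point U V w t $ Q3 a = t $ Q3 a"
  "dev23 a (W_point U V w t) = U a t" "dev34 a (W_point U V w t) = V a t" "dev24 (W_point U V w t) = w t"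
  by (simp_all add: W_point_def dev_defs)

lemma W_point_in_W:
  assumes "\<And>a. U a t * V a t = t $ Q3 a * (1 - t $ Q3 a) * w t"
  shows "W_point U V w t \<in> W"
  unfolding W_iff_dev W_point_simps using assms by (simp add: W_point_def)

lemma polynomial_function_W_point:
  assumes "\<And>a. real_polynomial_function (U a)" "\<And>a. real_polynomial_function (V a)"
    "real_polynomial_function w"
  shows "polynomial_function (W_point U V w)"
proof (rule polynomial_function_vecI)
  show "real_polynomial_function (\<lambda>t. W_point U V w t $ k)" for k
    by (cases k) (auto simp: W_point_def intro!: real_polynomial_function_intros assms)
qed

text \<open>If \<open>s\<^sub>1 * r\<^sub>1 = s\<^sub>2 * r\<^sub>2 = w\<close> and \<open>s\<^sub>i \<noteq> 0\<close>, then \<open>r\<^sub>1 = s\<^sub>2 * z\<close>, \<open>r\<^sub>2 = s\<^sub>1 * z\<close>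
  and \<open>w = s\<^sub>1 * s\<^sub>2 * z\<close> for some \<open>z\<close>. With \<open>s\<^sub>a\<close> and \<open>r\<^sub>a\<close> the quotients of the deviations by
  \<open>q\<^sub>3\<^sub>|\<^sub>a\<close> and \<open>1 - q\<^sub>3\<^sub>|\<^sub>a\<close> this gives a polynomial chart of \<open>W\<close>.
  The coordinates \<open>Q23 a\<close> and \<open>Q24\<close> of the parameter space carry \<open>s\<^sub>a\<close> and \<open>z\<close>.\<close>

definition chart_fst :: "2 \<Rightarrow> real ^ coord \<Rightarrow> real" where
  "chart_fst a t = t $ Q3 a * t $ Q23 a"

definition chart_snd :: "2 \<Rightarrow> real ^ coord \<Rightarrow> real" where
  "chart_snd a t = (1 - t $ Q3 a) * (t $ Q23 (flip a) * t $ Q24)"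

definition chart_w :: "real ^ coord \<Rightarrow> real" where
  "chart_w t = t $ Q23 1 * t $ Q23 2 * t $ Q24"

lemmas chart_defs = chart_fst_def chart_snd_def chart_w_def

lemma chart_w_eq: "chart_w t = t $ Q23 a * t $ Q23 (flip a) * t $ Q24"
  using exhaust_2[of a] by (auto simp: chart_w_def flip_def)

lemma chart_relation: "chart_fst a t * chart_snd a t = t $ Q3 a * (1 - t $ Q3 a) * chart_w t"
  unfolding chart_w_eq[of t a] by (simp add: chart_defs)

lemma polynomial_function_chart:
  "polynomial_function (W_point chart_fst chart_snd chart_w)"
  "polynomial_function (W_point chart_snd chart_fst chart_w)"
  by (rule polynomial_function_W_point; unfold chart_defs[abs_def]; intro real_polynomial_function_intros)+

text \<open>\<open>P\<close> names whichever family of deviations has a nonzero member,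
  \<open>R\<close> the other one, so that both cases share one proof. The chart passes through
  \<open>x\<close> and is inverted by the polynomials \<open>F\<close> up to factors
  \<open>m\<close> nonzero at \<open>p\<close>; both lower bounds follow.\<close>

lemma chart_at_regular_point:
  assumes x: "x \<in> W" and d: "\<And>a. x $ Q3 a \<noteq> 0" "\<And>a. x $ Q3 a \<noteq> 1"
    and PR: "P = dev23 \<and> R = dev34 \<or> P = dev34 \<and> R = dev23" and nz: "P i x \<noteq> 0"
  shows "local_dim (subtopology zariski W) x \<ge> enat 7 \<and> dim (zariski_tangent_space W x) \<ge> 7"
proof -
  define \<psi> where "\<psi> = (if P = dev23 \<and> R = dev34 then W_point chart_fst chart_snd chart_w
    else W_point chart_snd chart_fst chart_w)"
  have poly: "polynomial_function \<psi>" by (simp add: \<psi>_def polynomial_function_chart)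
  have range: "range \<psi> \<subseteq> W"
    using chart_relation by (auto simp: \<psi>_def mult.commute intro!: W_point_in_W)
  have \<psi>: "\<psi> t $ Q2 = t $ Q2" "\<psi> t $ Q4 = t $ Q4" "\<psi> t $ Q3 a = t $ Q3 a"
    "P a (\<psi> t) = chart_fst a t" "R a (\<psi> t) = chart_snd a t" "dev24 (\<psi> t) = chart_w t" for t a
    using PR by (auto simp: \<psi>_def W_point_simps)
  have PRx: "P a x * R a x = x $ Q3 a * (1 - x $ Q3 a) * dev24 x" for a
    using PR dev_mult[OF x, of a] by (auto simp: mult.commute)
  define s where "s a = P a x / x $ Q3 a" for a
  \<comment> \<open>Solves \<open>chart_snd (flip i) p = R (flip i) x\<close> for the parameter
    \<open>Q24\<close>. Only \<open>s i \<noteq> 0\<close> is available; \<open>s (flip i)\<close>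
    may vanish.\<close>
  define z where "z = R (flip i) x / ((1 - x $ Q3 (flip i)) * s i)"
  define p where "p = (\<chi> k. case k of Q2 \<Rightarrow> x $ Q2 | Q4 \<Rightarrow> x $ Q4 | Q3 a \<Rightarrow> x $ Q3 a
    | Q23 a \<Rightarrow> s a | Q24 \<Rightarrow> z | _ \<Rightarrow> 0)"
  have p: "p $ Q2 = x $ Q2" "p $ Q4 = x $ Q4" "p $ Q3 a = x $ Q3 a" "p $ Q23 a = s a" "p $ Q24 = z" for a
    by (simp_all add: p_def)
  have s: "s i \<noteq> 0" using nz d by (simp add: s_def)
  have d': "1 - x $ Q3 a \<noteq> 0" for a using d(2)[of a] by simp
  have flip_flip: "flip (flip i) = i" using exhaust_2[of i] by (auto simp: flip_def)
  have w: "dev24 x = s i * s (flip i) * z"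
  proof -
    have "s i * s (flip i) * z = P (flip i) x * R (flip i) x / (x $ Q3 (flip i) * (1 - x $ Q3 (flip i)))"
      using s by (simp add: z_def) (simp add: s_def)
    then show ?thesis unfolding PRx using d d'[of "flip i"] by simp
  qed
  have fst: "chart_fst a p = P a x" for a using d by (simp add: chart_fst_def p s_def)
  have snd: "chart_snd a p = R a x" for a
  proof -
    have "chart_snd (flip i) p = R (flip i) x"
      using s d'[of "flip i"] by (simp add: chart_snd_def p flip_flip z_def)
    \<comment> \<open>At the index \<open>i\<close> itself the value follows from the product
      relation, by cancelling \<open>P i x \<noteq> 0\<close>.\<close>
    moreover have "chart_snd i p = R i x"
    proof -
      have "P i x * chart_snd i p = P i x * R i x"
        unfolding fst[symmetric] chart_relation unfolding fst PRx
        by (simp add: p w chart_w_eq[of p i])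
      then show ?thesis using nz by simp
    qed
    ultimately show ?thesis
      using all_2_flip[of "\<lambda>a. chart_snd a p = R a x" i] by blast
  qed
  have wp: "chart_w p = dev24 x" by (simp add: chart_w_eq[of p i] p w)
  have dev: "dev23 a (\<psi> p) = dev23 a x \<and> dev34 a (\<psi> p) = dev34 a x" for a
    using PR \<psi>(4,5)[of a p] fst[of a] snd[of a] by auto
  have \<psi>p: "\<psi> p = x"
    by (rule W_eqI) (use range x dev in \<open>auto simp: \<psi> p wp\<close>)
  define K where "K = {Q2, Q4, Q24, Q3 1, Q3 2, Q23 1, Q23 2}"
  have card: "card K = 7" by (simp add: K_def)
  \<comment> \<open>The equations defining \<open>s\<close> and \<open>z\<close>, with denominators
    cleared to make them polynomial; the last case belongs to \<open>Q24\<close>.\<close>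
  define F where "F k q = (case k of Q2 \<Rightarrow> q $ Q2 - x $ Q2 | Q4 \<Rightarrow> q $ Q4 - x $ Q4
    | Q3 a \<Rightarrow> q $ Q3 a - x $ Q3 a | Q23 a \<Rightarrow> P a q - q $ Q3 a * s a
    | _ \<Rightarrow> q $ Q3 i * R (flip i) q - (1 - q $ Q3 (flip i)) * P i q * z)" for k q
  define m where "m k t = (case k of Q23 a \<Rightarrow> t $ Q3 a
    | Q24 \<Rightarrow> t $ Q3 i * (1 - t $ Q3 (flip i)) * t $ Q23 i | _ \<Rightarrow> 1)" for k and t :: "real ^ coord"
  have PRpoly: "real_polynomial_function (P a)" "real_polynomial_function (R a)" for a
    using PR real_polynomial_function_dev by auto
  have F: "real_polynomial_function (F k)" if "k \<in> K" for k
    using that unfolding K_def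
    by (auto simp: F_def[abs_def] intro!: real_polynomial_function_intros PRpoly)
  have m: "real_polynomial_function (m k)" if "k \<in> K" for k
    using that unfolding K_def by (auto simp: m_def[abs_def] intro!: real_polynomial_function_intros)
  have mp: "m k p \<noteq> 0" if "k \<in> K" for k
    using that d d' s unfolding K_def by (auto simp: m_def p)
  have Fm: "F k (\<psi> t) = m k t * (t $ k - p $ k)" if "k \<in> K" for k t
    using that unfolding K_def
    by (auto simp: F_def m_def \<psi> p chart_fst_def chart_snd_def flip_flip algebra_simps)
  have "enat (card K) \<le> local_dim (subtopology zariski W) (\<psi> p)"
    by (rule local_dim_ge_if_chart[OF poly range F m mp Fm])
  moreover have "card K \<le> dim (zariski_tangent_space W (\<psi> p))"
    by (rule dim_zariski_tangent_space_ge_if_chart[OF poly range F m mp Fm])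
  ultimately show ?thesis unfolding \<psi>p card ..
qed

section \<open>Tangent spaces of \<open>W\<close>\<close>

lemma zariski_tangent_space_W_equations:
  assumes v: "v \<in> zariski_tangent_space W x"
  shows "v $ Q23 a * x $ Q34 a + x $ Q23 a * v $ Q34 a = v $ Q3 a * x $ Q234 a + x $ Q3 a * v $ Q234 a" (is ?th1)
    and "v $ Q3 a * x $ Q24 + x $ Q3 a * v $ Q24 - (v $ Q23 a * x $ Q4 + x $ Q23 a * v $ Q4)
      - (v $ Q34 a * x $ Q2 + x $ Q34 a * v $ Q2) + v $ Q234 a
      = v $ Q24 - (v $ Q2 * x $ Q4 + x $ Q2 * v $ Q4)" (is ?th2)
proof -
  have nth: "((\<lambda>q :: real ^ coord. q $ k) has_derivative (\<lambda>v. v $ k)) (at x)" for k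
    by (intro bounded_linear_imp_has_derivative bounded_linear_vec_nth)
  have "(\<lambda>q. q $ Q23 a * q $ Q34 a - q $ Q3 a * q $ Q234 a) \<in> vanishing_ideal W"
    unfolding vanishing_ideal_def by (auto simp: W_def intro!: real_polynomial_function_intros)
  moreover have "((\<lambda>q. q $ Q23 a * q $ Q34 a - q $ Q3 a * q $ Q234 a) has_derivative
      (\<lambda>v. (x $ Q23 a * v $ Q34 a + v $ Q23 a * x $ Q34 a) - (x $ Q3 a * v $ Q234 a + v $ Q3 a * x $ Q234 a))) (at x)"
    by (intro has_derivative_diff has_derivative_mult nth)
  ultimately have "(x $ Q23 a * v $ Q34 a + v $ Q23 a * x $ Q34 a) -
      (x $ Q3 a * v $ Q234 a + v $ Q3 a * x $ Q234 a) = 0"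
    by (rule derivative_zero_on_zariski_tangent_space[OF v])
  then show ?th1 by (simp add: algebra_simps)
  have "(\<lambda>q. q $ Q3 a * q $ Q24 - q $ Q23 a * q $ Q4 - q $ Q34 a * q $ Q2 + q $ Q234 a
      - (q $ Q24 - q $ Q2 * q $ Q4)) \<in> vanishing_ideal W"
    unfolding vanishing_ideal_def by (auto simp: W_def intro!: real_polynomial_function_intros)
  moreover have "((\<lambda>q. q $ Q3 a * q $ Q24 - q $ Q23 a * q $ Q4 - q $ Q34 a * q $ Q2 + q $ Q234 a
      - (q $ Q24 - q $ Q2 * q $ Q4)) has_derivative
      (\<lambda>v. (x $ Q3 a * v $ Q24 + v $ Q3 a * x $ Q24) - (x $ Q23 a * v $ Q4 + v $ Q23 a * x $ Q4)
        - (x $ Q34 a * v $ Q2 + v $ Q34 a * x $ Q2) + v $ Q234 a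
        - (v $ Q24 - (x $ Q2 * v $ Q4 + v $ Q2 * x $ Q4)))) (at x)"
    by (intro has_derivative_diff has_derivative_add has_derivative_mult nth)
  ultimately have "(x $ Q3 a * v $ Q24 + v $ Q3 a * x $ Q24) - (x $ Q23 a * v $ Q4 + v $ Q23 a * x $ Q4)
        - (x $ Q34 a * v $ Q2 + v $ Q34 a * x $ Q2) + v $ Q234 a
        - (v $ Q24 - (x $ Q2 * v $ Q4 + v $ Q2 * x $ Q4)) = 0"
    by (rule derivative_zero_on_zariski_tangent_space[OF v])
  then show ?th2 by (simp add: algebra_simps)
qed

lemma coord_flip_cases:
  "k \<in> {Q2, Q4, Q24, Q3 i, Q3 (flip i), Q23 i, Q23 (flip i), Q34 i, Q34 (flip i), Q234 i, Q234 (flip i)}"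
  using exhaust_2[of i] UNIV_coord by (auto simp: flip_def)

text \<open>Four linear equations determine the four components outside \<open>K\<close>:
  \<open>Q234 (flip i)\<close> as \<open>q3\<close> is not 0, \<open>Q24\<close> as
  \<open>q3\<close> is not 1, then \<open>Q234 i\<close>, and finally \<open>Q34 i\<close> or
  \<open>Q23 i\<close> by the nonzero deviation.\<close>

lemma dim_zariski_tangent_space_W_le:
  assumes x: "x \<in> W" and d: "\<And>a. x $ Q3 a \<noteq> 0" "\<And>a. x $ Q3 a \<noteq> 1"
    and nz: "dev23 i x \<noteq> 0 \<or> dev34 i x \<noteq> 0"
  shows "dim (zariski_tangent_space W x) \<le> 7"
proof -
  define K where "K = {Q2, Q4, Q3 i, Q3 (flip i), Q23 (flip i), Q34 (flip i)} \<union>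
    (if dev23 i x \<noteq> 0 then {Q23 i} else {Q34 i})"
  have "flip i \<noteq> i" by (simp add: flip_def)
  then have card: "card K = 7" by (simp add: K_def)
  have "v = 0" if v: "v \<in> zariski_tangent_space W x" and 0: "\<And>k. k \<in> K \<Longrightarrow> v $ k = 0" for v
  proof -
    note eqs = zariski_tangent_space_W_equations[OF v]
    have z: "v $ Q2 = 0" "v $ Q4 = 0" "v $ Q3 i = 0" "v $ Q3 (flip i) = 0" "v $ Q23 (flip i) = 0"
      "v $ Q34 (flip i) = 0"
      by (auto intro!: 0 simp: K_def)
    have g2: "v $ Q234 (flip i) = 0" using eqs(1)[of "flip i"] z d by simp
    have "(1 - x $ Q3 (flip i)) * v $ Q24 = 0"
      using eqs(2)[of "flip i"] z g2 by (simp add: algebra_simps)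
    then have c: "v $ Q24 = 0" using d(2)[of "flip i"] by simp
    have g1: "v $ Q234 i = v $ Q23 i * x $ Q4 + v $ Q34 i * x $ Q2"
      using eqs(2)[of i] z c by simp
    have "v $ Q23 i * dev34 i x + v $ Q34 i * dev23 i x = 0"
      using eqs(1)[of i] z unfolding g1 by (simp add: dev_defs algebra_simps)
    moreover have "if dev23 i x \<noteq> 0 then v $ Q23 i = 0 else v $ Q34 i = 0"
      using 0[of "Q23 i"] 0[of "Q34 i"] by (simp add: K_def)
    ultimately have ef: "v $ Q23 i = 0" "v $ Q34 i = 0" using nz by (auto split: if_splits)
    have "v $ k = 0" for k
      using coord_flip_cases[of k i] by (auto simp: z ef c g1 g2)
    then show "v = 0" by (simp add: vec_eq_iff)
  qed
  then have "dim (zariski_tangent_space W x) \<le> card K"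
    by (rule dim_le_if_determined_by_coordinates[OF subspace_zariski_tangent_space])
  then show ?thesis by (simp add: card)
qed

text \<open>At a point where all deviations vanish, \<open>W\<close> contains eight lines with linearly
  independent directions.\<close>

lemma dim_zariski_tangent_space_W_ge:
  assumes x: "x \<in> W" and dev: "\<And>a. dev23 a x = 0" "\<And>a. dev34 a x = 0" and w: "dev24 x = 0"
  shows "dim (zariski_tangent_space W x) \<ge> 8"
proof -
  \<comment> \<open>The derivative at \<open>x\<close> of the parametrisation of points with
    \<open>w = 0\<close> by \<open>Q2\<close>, \<open>Q4\<close>, \<open>Q3 a\<close> and the
    deviations; \<open>Q23 a\<close> and \<open>Q34 a\<close> carry the directions of the
    deviations.\<close>
  define D :: "real ^ coord \<Rightarrow> real ^ coord" where "D v = (\<chi> k. case k of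
       Q2 \<Rightarrow> v $ Q2
     | Q4 \<Rightarrow> v $ Q4
     | Q24 \<Rightarrow> x $ Q4 * v $ Q2 + x $ Q2 * v $ Q4
     | Q3 a \<Rightarrow> v $ Q3 a
     | Q23 a \<Rightarrow> x $ Q3 a * v $ Q2 + x $ Q2 * v $ Q3 a + v $ Q23 a
     | Q34 a \<Rightarrow> x $ Q3 a * v $ Q4 + x $ Q4 * v $ Q3 a + v $ Q34 a
     | Q234 a \<Rightarrow> x $ Q3 a * x $ Q4 * v $ Q2 + x $ Q3 a * x $ Q2 * v $ Q4 + x $ Q2 * x $ Q4 * v $ Q3 a
         + x $ Q4 * v $ Q23 a + x $ Q2 * v $ Q34 a)" for v
  have lin: "linear D"
    by (rule linearI) (auto simp: D_def vec_eq_iff algebra_simps split: coord.split)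
  have x': "x $ Q24 = x $ Q2 * x $ Q4" "x $ Q23 a = x $ Q3 a * x $ Q2" "x $ Q34 a = x $ Q3 a * x $ Q4"
    "x $ Q234 a = x $ Q3 a * x $ Q2 * x $ Q4" for a
    using dev w x unfolding W_iff_dev by (simp_all add: dev_defs)
  \<comment> \<open>Along one axis the parametrisation is affine and at most one deviation becomes
    nonzero, so the product relation with \<open>w = 0\<close> persists.\<close>
  have line: "x + s *\<^sub>R D (axis k 1) \<in> W" for k s
    unfolding W_def D_def
    by (cases k) (auto simp: x' axis_def algebra_simps)
  have "D (axis k 1) \<in> zariski_tangent_space W x" for k
  proof -
    have "((\<lambda>s. x + s *\<^sub>R D (axis k 1)) has_derivative (\<lambda>s. s *\<^sub>R D (axis k 1))) (at 0)"
      by (auto intro!: derivative_eq_intros)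
    moreover have "range (\<lambda>s. x + s *\<^sub>R D (axis k 1)) \<subseteq> W" using line by auto
    ultimately have "1 *\<^sub>R D (axis k 1) \<in> zariski_tangent_space W (x + 0 *\<^sub>R D (axis k 1))"
      by (rule derivative_in_zariski_tangent_space)
    then show ?thesis by simp
  qed
  then have "(\<Sum>k\<in>UNIV. v $ k *\<^sub>R D (axis k 1)) \<in> zariski_tangent_space W x" for v
    by (intro subspace_sum subspace_scale subspace_zariski_tangent_space)
  moreover have "(\<Sum>k\<in>UNIV. v $ k *\<^sub>R D (axis k 1)) = D v" for v
  proof -
    have "D v = D (\<Sum>k\<in>UNIV. v $ k *\<^sub>R axis k 1)"
      using basis_expansion[of v] by (simp add: scalar_mult_eq_scaleR)
    then show ?thesis by (simp add: linear_sum[OF lin] linear_scale[OF lin])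
  qed
  ultimately have T: "D v \<in> zariski_tangent_space W x" for v by metis
  define K where "K = {Q2, Q4, Q3 1, Q3 2, Q23 1, Q23 2, Q34 1, Q34 2}"
  have "v = 0" if v: "\<And>k. k \<notin> K \<Longrightarrow> v $ k = 0" "D v = 0" for v
  proof -
    have Dv: "D v $ k = 0" for k using v(2) by simp
    have z: "v $ Q2 = 0" "v $ Q4 = 0" "v $ Q3 a = 0" for a
      using Dv[of Q2] Dv[of Q4] Dv[of "Q3 a"] by (simp_all add: D_def)
    have z': "v $ Q23 a = 0" "v $ Q34 a = 0" for a
      using Dv[of "Q23 a"] Dv[of "Q34 a"] by (simp_all add: D_def z)
    have "v $ k = 0" for k
      using v(1)[of k] by (cases k) (simp_all add: z z' K_def)
    then show "v = 0" by (simp add: vec_eq_iff)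
  qed
  then have "card K \<le> dim (zariski_tangent_space W x)"
    by (rule dim_ge_if_inj_on_coordinates[OF lin T])
  then show ?thesis by (simp add: K_def)
qed

text \<open>The local dimension is at most 7 everywhere. If all deviations vanish, so does
  \<open>dev24\<close> because \<open>q3 * (1 - q3) \<noteq> 0\<close>, and the tangent space has
  dimension at least 8; otherwise both dimensions are 7.\<close>

lemma singular_point_W_iff:
  assumes x: "x \<in> W" and d: "\<And>a. x $ Q3 a \<noteq> 0" "\<And>a. x $ Q3 a \<noteq> 1"
  shows "singular_point W x \<longleftrightarrow> (\<forall>a. dev23 a x = 0 \<and> dev34 a x = 0)"
proof -
  have le: "local_dim (subtopology zariski W) x \<le> enat 7"
    using local_dim_le_krull_dim[of x "subtopology zariski W"] krull_dim_W_le x by (auto intro: order_trans)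
  show ?thesis
  proof (cases "\<forall>a. dev23 a x = 0 \<and> dev34 a x = 0")
    case True
    have "dev24 x = 0" using dev_mult[OF x, of 1] True d[of 1] by simp
    then have "enat 8 \<le> enat (dim (zariski_tangent_space W x))"
      using dim_zariski_tangent_space_W_ge[OF x] True by simp
    moreover have "enat 7 < enat 8" by simp
    ultimately have "enat (dim (zariski_tangent_space W x)) \<noteq> local_dim (subtopology zariski W) x"
      using le by (metis leD order_trans)
    then show ?thesis using True x by (simp add: singular_point_def)
  next
    case False
    then obtain i where i: "dev23 i x \<noteq> 0 \<or> dev34 i x \<noteq> 0" by blast
    then have "local_dim (subtopology zariski W) x \<ge> enat 7 \<and> dim (zariski_tangent_space W x) \<ge> 7"
      using chart_at_regular_point[OF x d, of dev23 dev34 i] chart_at_regular_point[OF x d, of dev34 dev23 i]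
      by blast
    then have "local_dim (subtopology zariski W) x = enat 7" "dim (zariski_tangent_space W x) = 7"
      using le dim_zariski_tangent_space_W_le[OF x d i] by auto
    then show ?thesis using False by (simp add: singular_point_def)
  qed
qed

section \<open>The models\<close>

abbreviation prob :: "('v \<Rightarrow> 's) pmf \<Rightarrow> (('v \<Rightarrow> 's) \<Rightarrow> bool) \<Rightarrow> real" where
  "prob p Q \<equiv> measure (measure_pmf p) {i. Q i}"

lemma prob_pos:
  assumes "p \<in> positive_pmfs" "Q i"
  shows "prob p Q > 0"
proof (rule measure_pmf_posI)
  have "pmf p i > 0" using assms(1) by (simp add: positive_pmfs_def)
  then show "i \<in> set_pmf p" by (simp add: set_pmf_iff)
qed (use assms(2) in simp)

lemma prob_split_2:
  fixes p :: "('v \<Rightarrow> 2) pmf"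
  shows "prob p Q = prob p (\<lambda>i. Q i \<and> i v = 1) + prob p (\<lambda>i. Q i \<and> i v = 2)"
proof -
  have "{i. Q i} = {i. Q i \<and> i v = 1} \<union> {i. Q i \<and> i v = 2}" using exhaust_2 by auto
  moreover have "{i. Q i \<and> i v = 1} \<inter> {i. Q i \<and> i v = 2} = {}" by auto
  ultimately show ?thesis using measure_pmf.finite_measure_Union[of "{i. Q i \<and> i v = 1}" p] by simp
qed

lemma prob_True: "prob p (\<lambda>_. True) = 1"
  by simp

text \<open>Clearing denominators turns conditional independence into polynomial identities between
  probabilities.\<close>

lemma cond_indep_iff:
  "cond_indep p A B C \<longleftrightarrow> (\<forall>x y z. prob p (\<lambda>i. \<forall>v\<in>C. i v = z v) > 0 \<longrightarrow>
     prob p (\<lambda>i. ((\<forall>v\<in>A. i v = x v) \<and> (\<forall>v\<in>B. i v = y v)) \<and> (\<forall>v\<in>C. i v = z v)) *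
       prob p (\<lambda>i. \<forall>v\<in>C. i v = z v) =
     prob p (\<lambda>i. (\<forall>v\<in>A. i v = x v) \<and> (\<forall>v\<in>C. i v = z v)) *
     prob p (\<lambda>i. (\<forall>v\<in>B. i v = y v) \<and> (\<forall>v\<in>C. i v = z v)))"
proof -
  have eq: "a / c = b / c * (d / c) \<longleftrightarrow> a * c = b * d" if "c > 0" for a b c d :: real
    using that by (simp add: field_simps)
  show ?thesis
    by (simp only: cond_indep_def cond_prob_def space_measure_pmf UNIV_I simp_thms)
      (intro all_cong1 imp_cong refl, rule eq)
qed

section \<open>Configurations of four binary variables and independence\<close>

definition configuration :: "2 \<Rightarrow> 2 \<Rightarrow> 2 \<Rightarrow> 2 \<Rightarrow> 4 \<Rightarrow> 2" where
  "configuration a b c d v = (if v = 1 then a else if v = 2 then b else if v = 3 then c else d)"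

lemma configuration_simps [simp]:
  "configuration a b c d 1 = a" "configuration a b c d 2 = b"
  "configuration a b c d 3 = c" "configuration a b c d 4 = d"
  by (simp_all add: configuration_def)

lemma eq_configuration_iff:
  "i = configuration a b c d \<longleftrightarrow> i 1 = a \<and> i 2 = b \<and> i 3 = c \<and> i 4 = d"
  unfolding fun_eq_iff forall_4 by simp

lemma configuration_eta [simp]: "configuration (i 1) (i 2) (i 3) (i 4) = i"
  by (rule sym) (simp add: eq_configuration_iff)

lemma pmf_configuration:
  "pmf p (configuration a b c d) = prob p (\<lambda>i. i 1 = a \<and> i 2 = b \<and> i 3 = c \<and> i 4 = d)"
  unfolding eq_configuration_iff[symmetric] by (simp add: measure_pmf_single)

lemma prob_eq_sum_configurations:
  "prob p Q = (\<Sum>a\<in>UNIV. \<Sum>b\<in>UNIV. \<Sum>c\<in>UNIV. \<Sum>d\<in>UNIV.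
     if Q (configuration a b c d) then pmf p (configuration a b c d) else 0)"
proof -
  let ?f = "\<lambda>(a, b, c, d). configuration a b c d"
  let ?g = "\<lambda>i. if Q i then pmf p i else 0"
  have bij: "bij_betw ?f (UNIV \<times> UNIV \<times> UNIV \<times> UNIV) UNIV"
    by (rule bij_betwI[of _ _ _ "\<lambda>i. (i 1, i 2, i 3, i 4)"]) auto
  have "prob p Q = (\<Sum>i\<in>UNIV. ?g i)"
    by (simp add: measure_measure_pmf_finite sum.If_cases)
  also have "\<dots> = (\<Sum>x\<in>UNIV \<times> UNIV \<times> UNIV \<times> UNIV. ?g (?f x))"
    by (rule sum.reindex_bij_betw[OF bij, symmetric])
  also have "\<dots> = (\<Sum>a\<in>UNIV. \<Sum>b\<in>UNIV. \<Sum>c\<in>UNIV. \<Sum>d\<in>UNIV. ?g (configuration a b c d))"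
    by (simp only: sum.cartesian_product) (simp only: split_def fst_conv snd_conv)
  finally show ?thesis .
qed

text \<open>Mutual independence of \<open>(X_1, X_3)\<close>, \<open>X_2\<close> and
  \<open>X_4\<close>, stated for arbitrary events so that the marginal statements arise by inserting
  trivial ones.\<close>

definition indep_13_2_4 :: "(4 \<Rightarrow> 2) pmf \<Rightarrow> bool" where
  "indep_13_2_4 p \<longleftrightarrow> (\<forall>R S T. prob p (\<lambda>i. R (i 1) (i 3) \<and> S (i 2) \<and> T (i 4)) =
     prob p (\<lambda>i. R (i 1) (i 3)) * prob p (\<lambda>i. S (i 2)) * prob p (\<lambda>i. T (i 4)))"

text \<open>If the point probabilities factor, the sum over a product event separates into three
  sums. Taking two of the events trivial identifies each sum as a marginal probability.\<close>

lemma indep_13_2_4I: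
  assumes "\<And>a b c d. pmf p (configuration a b c d) =
    prob p (\<lambda>i. i 1 = a \<and> i 3 = c) * prob p (\<lambda>i. i 2 = b) * prob p (\<lambda>i. i 4 = d)"
  shows "indep_13_2_4 p"
  unfolding indep_13_2_4_def
proof (intro allI)
  fix R :: "2 \<Rightarrow> 2 \<Rightarrow> bool" and S T :: "2 \<Rightarrow> bool"
  define h where "h a c = prob p (\<lambda>i. i 1 = a \<and> i 3 = c)" for a c
  define k where "k b = prob p (\<lambda>i. i 2 = b)" for b
  define l where "l d = prob p (\<lambda>i. i 4 = d)" for d
  have one: "k 1 + k 2 = 1" "l 1 + l 2 = 1" "h 1 1 + h 1 2 + (h 2 1 + h 2 2) = 1"
  proof -
    show "k 1 + k 2 = 1" "l 1 + l 2 = 1"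
      unfolding k_def l_def using prob_split_2[of p "\<lambda>_. True"] by (simp_all add: prob_True)
    have "prob p (\<lambda>i. i 1 = a) = h a 1 + h a 2" for a
      unfolding h_def by (rule prob_split_2)
    then show "h 1 1 + h 1 2 + (h 2 1 + h 2 2) = 1"
      using prob_split_2[of p "\<lambda>_. True" 1] by (simp add: prob_True)
  qed
  have prod: "prob p (\<lambda>i. R (i 1) (i 3) \<and> S (i 2) \<and> T (i 4)) =
      (\<Sum>a\<in>UNIV. \<Sum>c\<in>UNIV. if R a c then h a c else 0) *
      (\<Sum>b\<in>UNIV. if S b then k b else 0) * (\<Sum>d\<in>UNIV. if T d then l d else 0)" for R S T
  proof -
    define r s t where "r a c = (if R a c then h a c else 0)"
      and "s b = (if S b then k b else 0)" and "t d = (if T d then l d else 0)" for a b c d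
    have "prob p (\<lambda>i. R (i 1) (i 3) \<and> S (i 2) \<and> T (i 4)) =
        (\<Sum>a\<in>UNIV. \<Sum>b\<in>UNIV. \<Sum>c\<in>UNIV. \<Sum>d\<in>UNIV. r a c * s b * t d)"
      unfolding prob_eq_sum_configurations
      by (intro sum.cong refl) (simp add: assms r_def s_def t_def h_def k_def l_def)
    also have "\<dots> = (\<Sum>a\<in>UNIV. \<Sum>c\<in>UNIV. r a c) * (\<Sum>b\<in>UNIV. s b) * (\<Sum>d\<in>UNIV. t d)"
      by (simp add: sum_2 algebra_simps)
    finally show ?thesis by (simp add: r_def s_def t_def)
  qed
  have "prob p (\<lambda>i. R (i 1) (i 3)) = (\<Sum>a\<in>UNIV. \<Sum>c\<in>UNIV. if R a c then h a c else 0)"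
    using prod[of R "\<lambda>_. True" "\<lambda>_. True"] one by (simp add: sum_2)
  moreover have "prob p (\<lambda>i. S (i 2)) = (\<Sum>b\<in>UNIV. if S b then k b else 0)"
    using prod[of "\<lambda>_ _. True" S "\<lambda>_. True"] one by (simp add: sum_2)
  moreover have "prob p (\<lambda>i. T (i 4)) = (\<Sum>d\<in>UNIV. if T d then l d else 0)"
    using prod[of "\<lambda>_ _. True" "\<lambda>_. True" T] one by (simp add: sum_2)
  ultimately show "prob p (\<lambda>i. R (i 1) (i 3) \<and> S (i 2) \<and> T (i 4)) =
      prob p (\<lambda>i. R (i 1) (i 3)) * prob p (\<lambda>i. S (i 2)) * prob p (\<lambda>i. T (i 4))"
    using prod by simp
qed

lemma indep_13_2_4_imp_cond_indep:
  assumes "indep_13_2_4 p"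
  shows "cond_indep p {1} {2, 4} {}" "cond_indep p {2} {1, 3, 4} {}" "cond_indep p {4} {1, 2, 3} {}"
    "cond_indep p {3} {2, 4} {1}" "cond_indep p {2} {4} {1, 3}"
proof -
  have ind: "prob p (\<lambda>i. R (i 1) (i 3) \<and> S (i 2) \<and> T (i 4)) =
     prob p (\<lambda>i. R (i 1) (i 3)) * prob p (\<lambda>i. S (i 2)) * prob p (\<lambda>i. T (i 4))" for R S T
    using assms unfolding indep_13_2_4_def by (elim allE)
  note ind3 = ind[of _ "\<lambda>b. b = _" "\<lambda>d. d = _"]
    and ind2 = ind[of _ "\<lambda>b. b = _" "\<lambda>_. True", simplified]
    and ind4 = ind[of _ "\<lambda>_. True" "\<lambda>d. d = _", simplified]
    and ind24 = ind[of "\<lambda>_ _. True" "\<lambda>b. b = _" "\<lambda>d. d = _", simplified]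
  show "cond_indep p {1} {2, 4} {}"
    unfolding cond_indep_iff
    using ind3[of "\<lambda>a c. a = _"] ind24 by simp
  show "cond_indep p {2} {1, 3, 4} {}"
    unfolding cond_indep_iff
    using ind3[of "\<lambda>a c. a = _ \<and> c = _"] ind4[of "\<lambda>a c. a = _ \<and> c = _"] by (simp add: conj_ac)
  show "cond_indep p {4} {1, 2, 3} {}"
    unfolding cond_indep_iff
    using ind3[of "\<lambda>a c. a = _ \<and> c = _"] ind2[of "\<lambda>a c. a = _ \<and> c = _"] by (simp add: conj_ac)
  show "cond_indep p {3} {2, 4} {1}"
    unfolding cond_indep_iff
    using ind3[of "\<lambda>a c. a = _ \<and> c = _"] ind3[of "\<lambda>a c. a = _"] by (simp add: conj_ac)
  show "cond_indep p {2} {4} {1, 3}"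
    unfolding cond_indep_iff
    using ind3[of "\<lambda>a c. a = _ \<and> c = _"] ind2[of "\<lambda>a c. a = _ \<and> c = _"]
      ind4[of "\<lambda>a c. a = _ \<and> c = _"] by (simp add: conj_ac)
qed

lemma model_II_G_sing_iff: "p \<in> model_II G_sing \<longleftrightarrow> p \<in> positive_pmfs \<and> indep_13_2_4 p"
proof
  assume "p \<in> model_II G_sing"
  then have pos: "p \<in> positive_pmfs" and ci2: "cond_indep p {2} {1, 3, 4} {}"
    and ci4: "cond_indep p {4} {1, 2, 3} {}"
    unfolding model_G_sing by blast+
  \<comment> \<open>\<open>cond_indep_mono\<close> shrinks the first set, hence the swap before
    passing from \<open>{1, 2, 3}\<close> to \<open>{1, 3}\<close>.\<close>
  have "cond_indep p {1, 2, 3} {4} {}" using ci4 by (subst cond_indep_commute)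
  then have ci4': "cond_indep p {1, 3} {4} {}" by (rule cond_indep_mono) auto
  have "indep_13_2_4 p"
  proof (rule indep_13_2_4I)
    fix a b c d :: 2
    let ?x = "configuration a b c d"
    have "pmf p ?x = prob p (\<lambda>i. i 2 = b) * prob p (\<lambda>i. i 1 = a \<and> i 3 = c \<and> i 4 = d)"
      using ci2[unfolded cond_indep_iff, rule_format, of _ ?x ?x]
      by (simp add: pmf_configuration conj_ac)
    also have "prob p (\<lambda>i. i 1 = a \<and> i 3 = c \<and> i 4 = d) = prob p (\<lambda>i. i 1 = a \<and> i 3 = c) * prob p (\<lambda>i. i 4 = d)"
      using ci4'[unfolded cond_indep_iff, rule_format, of _ ?x ?x] by (simp add: conj_ac)
    finally show "pmf p ?x = prob p (\<lambda>i. i 1 = a \<and> i 3 = c) * prob p (\<lambda>i. i 2 = b) * prob p (\<lambda>i. i 4 = d)"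
      by simp
  qed
  with pos show "p \<in> positive_pmfs \<and> indep_13_2_4 p" ..
next
  assume "p \<in> positive_pmfs \<and> indep_13_2_4 p"
  then show "p \<in> model_II G_sing" unfolding model_G_sing using indep_13_2_4_imp_cond_indep by blast
qed

section \<open>Coordinates of distributions in the type II model of \<open>G\<close>\<close>

lemma coordinates_simps:
  "coordinates p $ Q2 = prob p (\<lambda>i. i 2 = 1)"
  "coordinates p $ Q4 = prob p (\<lambda>i. i 4 = 1)"
  "coordinates p $ Q24 = prob p (\<lambda>i. i 2 = 1 \<and> i 4 = 1)"
  "coordinates p $ Q3 a = prob p (\<lambda>i. i 1 = a \<and> i 3 = 1) / prob p (\<lambda>i. i 1 = a)"
  "coordinates p $ Q23 a = prob p (\<lambda>i. i 1 = a \<and> i 3 = 1 \<and> i 2 = 1) / prob p (\<lambda>i. i 1 = a)"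
  "coordinates p $ Q34 a = prob p (\<lambda>i. i 1 = a \<and> i 3 = 1 \<and> i 4 = 1) / prob p (\<lambda>i. i 1 = a)"
  "coordinates p $ Q234 a = prob p (\<lambda>i. i 1 = a \<and> i 3 = 1 \<and> i 2 = 1 \<and> i 4 = 1) / prob p (\<lambda>i. i 1 = a)"
  by (simp_all add: coordinates_def cond_prob_def conj_ac)

context
  fixes p :: "(4 \<Rightarrow> 2) pmf"
  assumes p: "p \<in> model_II G"
begin

lemma positive_p: "p \<in> positive_pmfs"
  using p unfolding model_II_G by blast

lemma prob_1_pos: "prob p (\<lambda>i. i 1 = a) > 0"
  by (rule prob_pos[OF positive_p, of _ "\<lambda>_. a"]) simp

lemma prob_13_pos: "prob p (\<lambda>i. i 1 = a \<and> i 3 = c) > 0"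
  by (rule prob_pos[OF positive_p, of _ "configuration a 1 c 1"]) simp

lemma indep_2_4_given_13:
  "prob p (\<lambda>i. i 1 = a \<and> i 3 = c \<and> i 2 = b \<and> i 4 = d) * prob p (\<lambda>i. i 1 = a \<and> i 3 = c) =
   prob p (\<lambda>i. i 1 = a \<and> i 3 = c \<and> i 2 = b) * prob p (\<lambda>i. i 1 = a \<and> i 3 = c \<and> i 4 = d)"
proof -
  have "cond_indep p {2} {4} {1, 3}" using p unfolding model_II_G by blast
  from this[unfolded cond_indep_iff, rule_format, of "configuration a b c d"
      "configuration a b c d" "configuration a b c d"] prob_13_pos
  show ?thesis by (simp add: conj_ac)
qed

lemma indep_1_24: "prob p (\<lambda>i. i 1 = a \<and> i 2 = b \<and> i 4 = d) =
    prob p (\<lambda>i. i 1 = a) * prob p (\<lambda>i. i 2 = b \<and> i 4 = d)"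
proof -
  have "cond_indep p {1} {2, 4} {}" using p unfolding model_II_G by blast
  from this[unfolded cond_indep_iff, rule_format, of _ "configuration a b 1 d" "configuration a b 1 d"]
  show ?thesis by simp
qed

lemma indep_1_2: "prob p (\<lambda>i. i 1 = a \<and> i 2 = b) = prob p (\<lambda>i. i 1 = a) * prob p (\<lambda>i. i 2 = b)"
  using prob_split_2[of p "\<lambda>i. i 1 = a \<and> i 2 = b" 4] prob_split_2[of p "\<lambda>i. i 2 = b" 4]
  by (simp add: indep_1_24 distrib_left)

lemma indep_1_4: "prob p (\<lambda>i. i 1 = a \<and> i 4 = d) = prob p (\<lambda>i. i 1 = a) * prob p (\<lambda>i. i 4 = d)"
  using prob_split_2[of p "\<lambda>i. i 1 = a \<and> i 4 = d" 2] prob_split_2[of p "\<lambda>i. i 4 = d" 2]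
    indep_1_24[of a 1 d] indep_1_24[of a 2 d]
  by (simp add: conj_ac distrib_left)

lemma coordinates_Q3_bounds: "0 < coordinates p $ Q3 a" "coordinates p $ Q3 a < 1"
proof -
  show "0 < coordinates p $ Q3 a" using prob_1_pos prob_13_pos by (simp add: coordinates_simps)
  have "prob p (\<lambda>i. i 1 = a \<and> i 3 = 1) < prob p (\<lambda>i. i 1 = a)"
    using prob_split_2[of p "\<lambda>i. i 1 = a" 3] prob_13_pos[of a 2] by simp
  then show "coordinates p $ Q3 a < 1" using prob_1_pos[of a] by (simp add: coordinates_simps)
qed

text \<open>Independence of \<open>X_2\<close> and \<open>X_4\<close> given \<open>X_1 = a\<close>
  and \<open>X_3 = 1\<close> is the quadratic equation; subtracting it from the analogue for
  \<open>X_3 = 2\<close> gives the other one.\<close>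

lemma coordinates_in_W: "coordinates p \<in> W"
  unfolding W_def
proof (intro CollectI allI)
  fix a :: 2
  define N where "N = prob p (\<lambda>i. i 1 = a)"
  define D where "D c = prob p (\<lambda>i. i 1 = a \<and> i 3 = c)" for c
  define E where "E c = prob p (\<lambda>i. i 1 = a \<and> i 3 = c \<and> i 2 = 1)" for c
  define F where "F c = prob p (\<lambda>i. i 1 = a \<and> i 3 = c \<and> i 4 = 1)" for c
  define H where "H c = prob p (\<lambda>i. i 1 = a \<and> i 3 = c \<and> i 2 = 1 \<and> i 4 = 1)" for c
  define x y z where "x = coordinates p $ Q2" and "y = coordinates p $ Q4" and "z = coordinates p $ Q24"
  have N: "N > 0" unfolding N_def by (rule prob_1_pos)
  have EF: "H c * D c = E c * F c" for c
    unfolding H_def D_def E_def F_def by (rule indep_2_4_given_13)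
  \<comment> \<open>Independence of \<open>X_1\<close> and \<open>(X_2, X_4)\<close> makes the
    totals over \<open>X_3\<close> equal to \<open>N\<close> times unconditional
    probabilities.\<close>
  have sums: "D 2 = N - D 1" "E 2 = N * x - E 1" "F 2 = N * y - F 1" "H 2 = N * z - H 1"
  proof -
    show "D 2 = N - D 1"
      using prob_split_2[of p "\<lambda>i. i 1 = a" 3] by (simp add: D_def N_def)
    show "E 2 = N * x - E 1"
      using prob_split_2[of p "\<lambda>i. i 1 = a \<and> i 2 = 1" 3]
      by (simp add: E_def N_def x_def coordinates_simps indep_1_2 conj_ac)
    show "F 2 = N * y - F 1"
      using prob_split_2[of p "\<lambda>i. i 1 = a \<and> i 4 = 1" 3]
      by (simp add: F_def N_def y_def coordinates_simps indep_1_4 conj_ac)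
    show "H 2 = N * z - H 1"
      using prob_split_2[of p "\<lambda>i. i 1 = a \<and> i 2 = 1 \<and> i 4 = 1" 3]
      by (simp add: H_def N_def z_def coordinates_simps indep_1_24 conj_ac)
  qed
  define d e f g where "d = D 1 / N" and "e = E 1 / N" and "f = F 1 / N" and "g = H 1 / N"
  have scaled: "D 1 = N * d" "E 1 = N * e" "F 1 = N * f" "H 1 = N * g"
    using N by (simp_all add: d_def e_def f_def g_def)
  have "N\<^sup>2 * (g * d) = N\<^sup>2 * (e * f)"
    using EF[of 1] unfolding scaled by (simp add: power2_eq_square algebra_simps)
  then have 1: "g * d = e * f" using N by simp
  have "N\<^sup>2 * ((z - g) * (1 - d)) = N\<^sup>2 * ((x - e) * (y - f))"
    using EF[of 2] unfolding sums scaled by (simp add: power2_eq_square algebra_simps)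
  then have "(z - g) * (1 - d) = (x - e) * (y - f)" using N by simp
  with 1 have 2: "d * z - e * y - f * x + g = z - x * y" by algebra
  have "coordinates p $ Q3 a = d" "coordinates p $ Q23 a = e" "coordinates p $ Q34 a = f" "coordinates p $ Q234 a = g"
    by (simp_all add: coordinates_simps d_def e_def f_def g_def D_def E_def F_def H_def N_def)
  with 1 2 show "coordinates p $ Q23 a * coordinates p $ Q34 a = coordinates p $ Q3 a * coordinates p $ Q234 a \<and>
      coordinates p $ Q3 a * coordinates p $ Q24 - coordinates p $ Q23 a * coordinates p $ Q4
        - coordinates p $ Q34 a * coordinates p $ Q2 + coordinates p $ Q234 a
      = coordinates p $ Q24 - coordinates p $ Q2 * coordinates p $ Q4"
    by (simp add: x_def y_def z_def mult.commute)
qed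

lemma dev23_coordinates_eq_0_iff:
  "dev23 a (coordinates p) = 0 \<longleftrightarrow>
     prob p (\<lambda>i. i 1 = a \<and> i 3 = 1 \<and> i 2 = 1) = prob p (\<lambda>i. i 1 = a \<and> i 3 = 1) * prob p (\<lambda>i. i 2 = 1)"
  using prob_1_pos[of a] by (auto simp: dev23_def coordinates_simps field_simps)

lemma dev34_coordinates_eq_0_iff:
  "dev34 a (coordinates p) = 0 \<longleftrightarrow>
     prob p (\<lambda>i. i 1 = a \<and> i 3 = 1 \<and> i 4 = 1) = prob p (\<lambda>i. i 1 = a \<and> i 3 = 1) * prob p (\<lambda>i. i 4 = 1)"
  using prob_1_pos[of a] by (auto simp: dev34_def coordinates_simps field_simps)

text \<open>With binary variables one cell and the margins fix the rest: complements are taken first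
  in \<open>X_3\<close>, then in \<open>X_v\<close>.\<close>

lemma prob_13v_product:
  assumes "prob p (\<lambda>i. i 1 = a \<and> i 3 = 1 \<and> i v = 1) = prob p (\<lambda>i. i 1 = a \<and> i 3 = 1) * prob p (\<lambda>i. i v = 1)"
    and "prob p (\<lambda>i. i 1 = a \<and> i v = 1) = prob p (\<lambda>i. i 1 = a) * prob p (\<lambda>i. i v = 1)"
  shows "prob p (\<lambda>i. i 1 = a \<and> i 3 = c \<and> i v = b) = prob p (\<lambda>i. i 1 = a \<and> i 3 = c) * prob p (\<lambda>i. i v = b)"
proof -
  have b1: "prob p (\<lambda>i. i 1 = a \<and> i 3 = c \<and> i v = 1) = prob p (\<lambda>i. i 1 = a \<and> i 3 = c) * prob p (\<lambda>i. i v = 1)" for c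
  proof (cases "c = 1")
    case False
    then have "c = 2" using exhaust_2[of c] by simp
    then show ?thesis
      using assms prob_split_2[of p "\<lambda>i. i 1 = a \<and> i v = 1" 3] prob_split_2[of p "\<lambda>i. i 1 = a" 3]
      by (simp add: conj_ac algebra_simps)
  qed (use assms in simp)
  show ?thesis
  proof (cases "b = 1")
    case False
    then have "b = 2" using exhaust_2[of b] by simp
    moreover have "prob p (\<lambda>i. i v = 2) = 1 - prob p (\<lambda>i. i v = 1)"
      using prob_split_2[of p "\<lambda>_. True" v] by (simp add: prob_True)
    moreover have "prob p (\<lambda>i. i 1 = a \<and> i 3 = c \<and> i v = 2) =
        prob p (\<lambda>i. i 1 = a \<and> i 3 = c) - prob p (\<lambda>i. i 1 = a \<and> i 3 = c \<and> i v = 1)"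
      using prob_split_2[of p "\<lambda>i. i 1 = a \<and> i 3 = c" v] by simp
    ultimately show ?thesis unfolding b1 by (simp only: right_diff_distrib mult_1_right)
  qed (use b1 in simp)
qed

lemma dev_coordinates_eq_0_iff:
  "(\<forall>a. dev23 a (coordinates p) = 0 \<and> dev34 a (coordinates p) = 0) \<longleftrightarrow> indep_13_2_4 p"
proof
  assume "indep_13_2_4 p"
  then have ind: "prob p (\<lambda>i. R (i 1) (i 3) \<and> S (i 2) \<and> T (i 4)) =
     prob p (\<lambda>i. R (i 1) (i 3)) * prob p (\<lambda>i. S (i 2)) * prob p (\<lambda>i. T (i 4))" for R S T
    unfolding indep_13_2_4_def by (elim allE)
  show "\<forall>a. dev23 a (coordinates p) = 0 \<and> dev34 a (coordinates p) = 0"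
  proof (intro allI conjI)
    fix a :: 2
    show "dev23 a (coordinates p) = 0"
      unfolding dev23_coordinates_eq_0_iff
      using ind[of "\<lambda>b c. b = a \<and> c = 1" "\<lambda>b. b = 1" "\<lambda>_. True"] by (simp add: conj_ac)
    show "dev34 a (coordinates p) = 0"
      unfolding dev34_coordinates_eq_0_iff
      using ind[of "\<lambda>b c. b = a \<and> c = 1" "\<lambda>_. True" "\<lambda>d. d = 1"] by (simp add: conj_ac)
  qed
next
  assume dev: "\<forall>a. dev23 a (coordinates p) = 0 \<and> dev34 a (coordinates p) = 0"
  show "indep_13_2_4 p"
  proof (rule indep_13_2_4I)
    fix a b c d :: 2
    have 2: "prob p (\<lambda>i. i 1 = a \<and> i 3 = c \<and> i 2 = b) = prob p (\<lambda>i. i 1 = a \<and> i 3 = c) * prob p (\<lambda>i. i 2 = b)"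
      by (rule prob_13v_product) (use dev dev23_coordinates_eq_0_iff indep_1_2 in auto)
    have 4: "prob p (\<lambda>i. i 1 = a \<and> i 3 = c \<and> i 4 = d) = prob p (\<lambda>i. i 1 = a \<and> i 3 = c) * prob p (\<lambda>i. i 4 = d)"
      by (rule prob_13v_product) (use dev dev34_coordinates_eq_0_iff indep_1_4 in auto)
    \<comment> \<open>Conditional independence of \<open>X_2\<close> and \<open>X_4\<close> is
      combined with the factorisations \<open>2\<close> and \<open>4\<close>, and the positive
      probability of the conditioning event is cancelled.\<close>
    have "prob p (\<lambda>i. i 1 = a \<and> i 3 = c \<and> i 2 = b \<and> i 4 = d) =
        prob p (\<lambda>i. i 1 = a \<and> i 3 = c) * prob p (\<lambda>i. i 2 = b) * prob p (\<lambda>i. i 4 = d)"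
      using indep_2_4_given_13[of a c b d] prob_13_pos[of a c] unfolding 2 4 by simp
    then show "pmf p (configuration a b c d) =
        prob p (\<lambda>i. i 1 = a \<and> i 3 = c) * prob p (\<lambda>i. i 2 = b) * prob p (\<lambda>i. i 4 = d)"
      by (simp add: pmf_configuration conj_ac)
  qed
qed

end

theorem proposition15:
  shows "singular_locus = model_II G_sing \<and>
    (model_II G_sing :: (4 \<Rightarrow> 2) pmf set) = model_IV G_sing"
proof
  have singular: "singular_point W (coordinates p) \<longleftrightarrow> indep_13_2_4 p" if p: "p \<in> model_II G" for p
    unfolding dev_coordinates_eq_0_iff[OF p, symmetric]
    using coordinates_Q3_bounds[OF p] by (intro singular_point_W_iff coordinates_in_W[OF p]) (metis less_irrefl)+
  \<comment> \<open>The singular locus is taken inside the model of \<open>G\<close>, so the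
    submodel has to be contained in that model.\<close>
  have "p \<in> model_II G" if "p \<in> model_II G_sing" for p :: "(4 \<Rightarrow> 2) pmf"
    using that indep_13_2_4_imp_cond_indep[of p] unfolding model_II_G_sing_iff model_II_G by simp
  moreover have "p \<in> positive_pmfs" if "p \<in> model_II G" for p :: "(4 \<Rightarrow> 2) pmf"
    using that unfolding model_II_G by simp
  ultimately have "p \<in> singular_locus \<longleftrightarrow> p \<in> model_II G_sing" for p
    unfolding singular_locus_def mem_Collect_eq using singular[of p] model_II_G_sing_iff[of p] by metis
  then show "singular_locus = model_II G_sing" by (rule set_eqI)
  show "(model_II G_sing :: (4 \<Rightarrow> 2) pmf set) = model_IV G_sing"
    by (rule set_eqI) (simp only: model_G_sing)
qed

end
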